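(* Let $q>0$ be a real number. The MLB transform $B_q$ is an isometric isomorphism mapping $L^2(\mathbb{R})$ onto the Mittag-Leffler Fock space $ML_q(\mathbb{C})$.
   Context: $L^2(\mathbb{R})$ is the space of complex-valued square integrable functions on $\mathbb{R}$, with inner product $\langle\phi,\psi\rangle_{L^2(\mathbb{R})}=\int_{\mathbb{R}}\phi(t)\overline{\psi(t)}\,dt$. The normalized Hermite functions $\psi_n$, $n\ge 0$, are $\psi_n(x)=(2^n n!\sqrt{\pi})^{-1/2}H_n(x)e^{-x^2/2}$ with $H_n$ the (physicists') Hermite polynomials; they form an orthonormal basis of $L^2(\mathbb{R})$. For $q>0$ the Mittag-Leffler Fock space $ML_q(\mathbb{C})$ is the Hilbert space of entire functions $f$ with $$\|f\|^2_{ML_q(\mathbb{C})}=\frac{1}{q\pi}\int_{\mathbb{C}}|f(z)|^2|z|^{\frac{2}{q}-2}e^{-|z|^{2/q}}\,dA(z)<\infty,$$ where $dA(z)=dx\,dy$ for $z=x+iy$. The ML-Bargmann kernel is $$A_q(z,x)=\sum_{n=0}^\infty\frac{\overline{z}^{\,n}}{\sqrt{\Gamma(qn+1)}}\psi_n(x),\qquad z\in\mathbb{C},\ x\in\mathbb{R},$$ and the Mittag-Leffler Bargmann (MLB) transform of $\phi\in L^2(\mathbb{R})$ is $$B_q(\phi)(z)=\int_{\mathbb{R}}\overline{A_q(z,x)}\,\phi(x)\,dx,\qquad z\in\mathbb{C}.$$ *)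

theory Defs
  imports "HOL-Analysis.Analysis"
begin

text \<open>Physicists' Hermite polynomials, by Rodrigues' formula.\<close>

definition hermite :: "nat \<Rightarrow> real \<Rightarrow> real" where
  "hermite n x = (-1) ^ n * exp (x\<^sup>2) * (deriv ^^ n) (\<lambda>t. exp (- t\<^sup>2)) x"

definition hermite_fun :: "nat \<Rightarrow> real \<Rightarrow> real" where
  "hermite_fun n x = hermite n x * exp (- x\<^sup>2 / 2) / sqrt (2 ^ n * fact n * sqrt pi)"

text \<open>Elements of \<open>L2\<close> are functions, not classes modulo almost-everywhere equality; the
  identification of functions that agree almost everywhere has to be made where \<open>L2\<close> is used.\<close>

definition L2 :: "(real \<Rightarrow> complex) set" where
  "L2 = {\<phi>. \<phi> \<in> borel_measurable lebesgue \<and> integrable lebesgue (\<lambda>t. (norm (\<phi> t))\<^sup>2)}"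

definition L2_norm :: "(real \<Rightarrow> complex) \<Rightarrow> real" where
  "L2_norm \<phi> = sqrt (LINT t|lebesgue. (norm (\<phi> t))\<^sup>2)"

text \<open>At the origin \<open>powr\<close> gives the value 0 for every exponent, in particular when \<open>q = 1\<close>;
  this only affects a null set.\<close>

definition mittag_leffler_density :: "real \<Rightarrow> complex \<Rightarrow> real" where
  "mittag_leffler_density q z = norm z powr (2 / q - 2) * exp (- (norm z powr (2 / q)))"

definition mittag_leffler_Fock :: "real \<Rightarrow> (complex \<Rightarrow> complex) set" where
  "mittag_leffler_Fock q = {f. f holomorphic_on UNIV \<and>
     integrable lebesgue (\<lambda>z. (norm (f z))\<^sup>2 * mittag_leffler_density q z)}"

definition mittag_leffler_norm :: "real \<Rightarrow> (complex \<Rightarrow> complex) \<Rightarrow> real" where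
  "mittag_leffler_norm q f = sqrt (1 / (q * pi) * (LINT z|lebesgue. (norm (f z))\<^sup>2 * mittag_leffler_density q z))"

definition MLB_kernel_term :: "real \<Rightarrow> complex \<Rightarrow> real \<Rightarrow> nat \<Rightarrow> complex" where
  "MLB_kernel_term q z x n =
     cnj z ^ n / of_real (sqrt (Gamma (q * real n + 1))) * of_real (hermite_fun n x)"

definition MLB_kernel :: "real \<Rightarrow> complex \<Rightarrow> real \<Rightarrow> complex" where
  "MLB_kernel q z x = (\<Sum>n. MLB_kernel_term q z x n)"

definition MLB :: "real \<Rightarrow> (real \<Rightarrow> complex) \<Rightarrow> complex \<Rightarrow> complex" where
  "MLB q \<phi> z = (LINT x|lebesgue. cnj (MLB_kernel q z x) * \<phi> x)"

end

theory Submission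
  imports Defs "HOL-Probability.Probability" "HOL-Complex_Analysis.Complex_Analysis"
begin

text \<open>
  Integrating the kernel series term by term gives \<open>B\<^sub>q \<phi>(z) = (\<Sum>n. a\<^sub>n z\<^sup>n / sqrt (\<Gamma>(q n + 1)))\<close>,
  where the \<open>a\<^sub>n\<close> are the Hermite coefficients of \<open>\<phi>\<close>. An entire function \<open>\<Sum>n. c\<^sub>n z\<^sup>n\<close> has
  squared Fock norm \<open>\<Sum>n. |c\<^sub>n|\<^sup>2 \<Gamma>(q n + 1)\<close>, finite or not, because the weight is radial and its
  moments are Gamma integrals. Hence \<open>B\<^sub>q\<close> becomes the identity of \<open>\<ell>\<^sup>2\<close> in the two coefficient
  systems, and it remains to see that \<open>\<phi> \<mapsto> (a\<^sub>n)\<close> is a unitary map onto \<open>\<ell>\<^sup>2\<close>. It is onto by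
  Riesz-Fischer. It is injective because the vanishing of all coefficients makes all derivatives
  at 0 of the Fourier transform of \<open>\<phi>(x) exp (-x\<^sup>2/2)\<close> vanish, hence the transform itself, and then
  \<open>\<phi> = 0\<close> almost everywhere by Levy's uniqueness theorem.
\<close>

subsection \<open>Hermite functions\<close>

text \<open>Termwise integration of the kernel needs two crude bounds. For fixed \<open>x\<close>
  the Hermite functions grow at most geometrically in \<open>n\<close>, whereas
  \<open>Gamma (q * n + 1)\<close> outgrows every geometric sequence, whatever \<open>q > 0\<close>
  is; and the integrals of \<open>\<bar>hermite_fun n x\<bar> * norm (\<phi> x)\<close> are bounded
  uniformly in \<open>n\<close>.

  The Fock norm is computed with nonnegative integrals, so the formula may be applied before the
  norm is known to be finite; surjectivity reads it in that direction. In place of polar coordinates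
  there are rotation invariance of the area and the push-forward of area under
  \<open>norm z powr (2 / q)\<close>, the substitution that turns the exponential factor of the
  weight into \<open>exp (- t)\<close>.

  Parseval's identity is a consequence of the other two facts: Riesz-Fischer supplies a function
  with the same coefficients and the right norm, and completeness identifies it with the given one.
  Levy's theorem concerns probability measures on the Borel sets; this forces the reductions to real
  functions, to their positive and negative parts, and to Borel versions of Lebesgue measurable
  functions.\<close>

primrec hermite_poly :: "nat \<Rightarrow> real poly" where
  "hermite_poly 0 = 1"
| "hermite_poly (Suc n) = [:0, 2:] * hermite_poly n - pderiv (hermite_poly n)"

text \<open>The derivative of \<open>p * exp (- x^2)\<close> is
  \<open>(p' - 2 x p) * exp (- x^2)\<close>, the negative of the step that defines
  \<open>hermite_poly\<close>; hence one sign per derivative.\<close>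

lemma deriv_iter_gaussian:
  "(deriv ^^ n) (\<lambda>t::real. exp (- t\<^sup>2)) = (\<lambda>x. (-1) ^ n * poly (hermite_poly n) x * exp (- x\<^sup>2))"
proof (induction n)
  case (Suc n)
  have "((\<lambda>x. (-1) ^ n * poly (hermite_poly n) x * exp (- x\<^sup>2)) has_real_derivative
          (-1) ^ Suc n * poly (hermite_poly (Suc n)) x * exp (- x\<^sup>2)) (at x)" for x
    by (auto intro!: derivative_eq_intros simp: algebra_simps)
  then show ?case
    by (auto simp: Suc fun_eq_iff intro!: DERIV_imp_deriv)
qed simp

lemma hermite_eq_poly: "hermite n x = poly (hermite_poly n) x"
proof -
  have "((-1::real) ^ n) * (-1) ^ n = 1"
    by (simp flip: power_mult_distrib)
  moreover have "exp (x\<^sup>2) * exp (- x\<^sup>2) = 1"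
    by (simp flip: exp_add)
  ultimately show ?thesis
    unfolding hermite_def deriv_iter_gaussian by (metis (no_types, opaque_lifting) mult.assoc mult.commute mult_1)
qed

text \<open>Differentiating the recursion leaves \<open>2 X p' - p''\<close> with
  \<open>p = hermite_poly (Suc n)\<close>; the induction hypothesis turns this into a multiple of
  the recursion itself. The relation eliminates the derivative from the recursion and makes
  integration by parts lower the index.\<close>

lemma pderiv_hermite_poly: "pderiv (hermite_poly (Suc n)) = smult (2 * real (Suc n)) (hermite_poly n)"
proof (induction n)
  case 0
  then show ?case by (simp add: pderiv_pCons)
next
  case (Suc n)
  have "pderiv (hermite_poly (Suc (Suc n))) =
      smult 2 (hermite_poly (Suc n)) + [:0, 2:] * pderiv (hermite_poly (Suc n)) - pderiv (pderiv (hermite_poly (Suc n)))"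
    unfolding hermite_poly.simps(2)[of "Suc n"]
    by (simp add: pderiv_diff pderiv_mult pderiv_smult pderiv_pCons del: hermite_poly.simps)
  also have "\<dots> = smult 2 (hermite_poly (Suc n)) + smult (2 * real (Suc n)) (hermite_poly (Suc n))"
    unfolding Suc by (simp add: pderiv_smult smult_diff_right algebra_simps)
  also have "\<dots> = smult (2 * real (Suc (Suc n))) (hermite_poly (Suc n))"
    by (simp add: algebra_simps flip: smult_add_left del: hermite_poly.simps)
  finally show ?case .
qed

lemma hermite_rec: "hermite (Suc (Suc n)) x = 2 * x * hermite (Suc n) x - 2 * real (Suc n) * hermite n x"
  unfolding hermite_eq_poly hermite_poly.simps(2)[of "Suc n"] pderiv_hermite_poly by simp

section \<open>Gaussian integrals of polynomials and orthogonality\<close>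

text \<open>Up to the factor \<open>sqrt pi\<close>, the Gaussian is the centred normal density of
  variance 1/2, all of whose moments exist.\<close>

lemma integrable_power_gaussian: "integrable lborel (\<lambda>x::real. x ^ n * exp (- x\<^sup>2))"
proof -
  have "integrable lborel (\<lambda>x. sqrt pi * (normal_density 0 (sqrt (1/2)) x * (x - 0) ^ n))"
    by (intro integrable_mult_right integrable_normal_moment) auto
  then show ?thesis
    by (simp add: normal_density_def field_simps)
qed

lemma integrable_poly_gaussian: "integrable lborel (\<lambda>x::real. poly p x * exp (- x\<^sup>2))"
  by (auto simp: poly_altdef sum_distrib_right mult.assoc intro!: Bochner_Integration.integrable_sum integrable_mult_right integrable_power_gaussian)

lemma tendsto_poly_gaussian_at_top: "((\<lambda>x::real. poly p x * exp (- x\<^sup>2)) \<longlongrightarrow> 0) at_top"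
proof -
  have "((\<lambda>x::real. coeff p i * (x ^ i * exp (- x\<^sup>2))) \<longlongrightarrow> coeff p i * 0) at_top" for i
    by (intro tendsto_mult tendsto_const) real_asymp
  then have "((\<lambda>x::real. \<Sum>i\<le>degree p. coeff p i * (x ^ i * exp (- x\<^sup>2))) \<longlongrightarrow> (\<Sum>i\<le>degree p. 0)) at_top"
    by (intro tendsto_sum) simp
  then show ?thesis
    by (simp add: poly_altdef sum_distrib_right mult.assoc)
qed

lemma tendsto_poly_gaussian_at_bot: "((\<lambda>x::real. poly p x * exp (- x\<^sup>2)) \<longlongrightarrow> 0) at_bot"
  using tendsto_poly_gaussian_at_top[of "p \<circ>\<^sub>p [:0, -1:]"]
  by (simp add: filterlim_at_bot_mirror poly_pcompose)

text \<open>The integrand is the derivative of \<open>p * exp (- x^2)\<close>, which vanishes at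
  both ends of the line. This is integration by parts in the form in which orthogonality uses
  it.\<close>

lemma integral_deriv_poly_gaussian:
  fixes p :: "real poly"
  shows "(\<integral>x. poly (pderiv p - [:0, 2:] * p) x * exp (- x\<^sup>2) \<partial>lborel) = 0"
proof -
  have "(LBINT x=-\<infinity>..\<infinity>. poly (pderiv p - [:0, 2:] * p) x * exp (- x\<^sup>2)) = 0 - 0"
  proof (rule interval_integral_FTC_integrable[where F="\<lambda>x. poly p x * exp (- x\<^sup>2)"])
    show "((\<lambda>x. poly p x * exp (- x\<^sup>2)) has_vector_derivative poly (pderiv p - [:0, 2:] * p) x * exp (- x\<^sup>2)) (at x)" for x
      unfolding has_real_derivative_iff_has_vector_derivative[symmetric]
      by (auto intro!: derivative_eq_intros simp: algebra_simps)
    show "set_integrable lborel (einterval (- \<infinity>) \<infinity>) (\<lambda>x. poly (pderiv p - [:0, 2:] * p) x * exp (- x\<^sup>2))"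
      using integrable_poly_gaussian unfolding set_integrable_def by (simp del: poly_diff poly_mult)
    show "(((\<lambda>x. poly p x * exp (- x\<^sup>2)) \<circ> real_of_ereal) \<longlongrightarrow> 0) (at_right (- \<infinity>))"
      using tendsto_poly_gaussian_at_bot by (simp add: ereal_tendsto_simps)
    show "(((\<lambda>x. poly p x * exp (- x\<^sup>2)) \<circ> real_of_ereal) \<longlongrightarrow> 0) (at_left \<infinity>)"
      using tendsto_poly_gaussian_at_top by (simp add: ereal_tendsto_simps)
  qed (auto intro!: continuous_intros)
  then show ?thesis
    by (simp add: interval_lebesgue_integral_def set_lebesgue_integral_def)
qed

lemma integral_gaussian: "(\<integral>x. exp (- x\<^sup>2) \<partial>lborel) = sqrt pi"
proof -
  have "(\<integral>x. sqrt pi * normal_density 0 (sqrt (1/2)) x \<partial>lborel) = sqrt pi"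
    by (simp add: integral_normal_density)
  then show ?thesis
    by (simp add: normal_density_def)
qed

text \<open>With respect to the Gaussian weight, \<open>2 X p - p'\<close> is adjoint to
  differentiation (this is \<open>step\<close>). Moving it from one factor to the other lowers both
  indices by one and contributes the factor \<open>2 * Suc k\<close>, until one of the indices is
  0.\<close>

lemma hermite_poly_orthogonal:
  "(\<integral>x. poly (hermite_poly n * hermite_poly m) x * exp (- x\<^sup>2) \<partial>lborel) =
    (if n = m then 2 ^ n * fact n * sqrt pi else 0)"
proof -
  let ?I = "\<lambda>p. \<integral>x. poly p x * exp (- x\<^sup>2) \<partial>(lborel :: real measure)"
  have step: "?I (hermite_poly (Suc n) * p) = ?I (hermite_poly n * pderiv p)" for n p
  proof -
    have "hermite_poly (Suc n) * p =
        hermite_poly n * pderiv p - (pderiv (hermite_poly n * p) - [:0, 2:] * (hermite_poly n * p))"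
      by (simp add: pderiv_mult algebra_simps)
    then have "?I (hermite_poly (Suc n) * p) =
        ?I (hermite_poly n * pderiv p) - ?I (pderiv (hermite_poly n * p) - [:0, 2:] * (hermite_poly n * p))"
      by (simp only: poly_diff[of "hermite_poly n * pderiv p"] left_diff_distrib
          Bochner_Integration.integral_diff[OF integrable_poly_gaussian integrable_poly_gaussian])
    then show ?thesis
      by (simp only: integral_deriv_poly_gaussian diff_zero)
  qed
  show ?thesis
  proof (induction n arbitrary: m)
    case 0
    show ?case
    proof (cases m)
      case 0
      then show ?thesis by (simp add: integral_gaussian)
    next
      case (Suc k)
      have "?I (hermite_poly m * hermite_poly 0) = 0"
        unfolding Suc step by simp
      then show ?thesis by (simp add: Suc mult.commute del: hermite_poly.simps)
    qed
  next
    case (Suc n)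
    show ?case
    proof (cases m)
      case 0
      then show ?thesis unfolding step by simp
    next
      case (Suc k)
      have "?I (hermite_poly n * smult c (hermite_poly k)) = c * ?I (hermite_poly n * hermite_poly k)" for c
        by (simp add: mult_ac flip: integral_mult_right_zero)
      then show ?thesis
        unfolding Suc step pderiv_hermite_poly Suc.IH[of k] by simp
    qed
  qed
qed

section \<open>Normalized Hermite functions and their growth in the index\<close>

lemma hermite_fun_measurable [measurable]: "hermite_fun n \<in> borel_measurable borel"
proof -
  have "continuous_on UNIV (hermite_fun n)"
    unfolding hermite_fun_def[abs_def] hermite_eq_poly by (intro continuous_intros) auto
  then show ?thesis
    by (rule borel_measurable_continuous_onI)
qed

lemma hermite_fun_mult:
  "hermite_fun n x * hermite_fun m x =
    poly (hermite_poly n * hermite_poly m) x * exp (- x\<^sup>2) /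
      (sqrt (2 ^ n * fact n * sqrt pi) * sqrt (2 ^ m * fact m * sqrt pi))"
proof -
  have "exp (- x\<^sup>2 / 2) * exp (- x\<^sup>2 / 2) = exp (- x\<^sup>2)"
    by (simp flip: exp_add)
  then show ?thesis
    by (simp add: hermite_fun_def hermite_eq_poly)
qed

lemma integrable_hermite_fun_mult: "integrable lborel (\<lambda>x. hermite_fun n x * hermite_fun m x)"
  unfolding hermite_fun_mult by (intro integrable_divide integrable_poly_gaussian)

lemma hermite_fun_orthonormal:
  "(\<integral>x. hermite_fun n x * hermite_fun m x \<partial>lborel) = (if n = m then 1 else 0)"
  unfolding hermite_fun_mult by (simp add: hermite_poly_orthogonal del: poly_mult)

text \<open>The normalization is what brings both square roots down to at most 1; the coefficients
  of \<open>hermite_rec\<close> grow with \<open>n\<close>.\<close>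

lemma hermite_fun_rec:
  "hermite_fun (Suc (Suc n)) x =
    sqrt (2 / real (n + 2)) * x * hermite_fun (Suc n) x - sqrt (real (n + 1) / real (n + 2)) * hermite_fun n x"
proof -
  define c where "c = sqrt (2 ^ n * fact n * sqrt pi)"
  have c: "c > 0"
    by (simp add: c_def)
  \<comment> \<open>In terms of \<open>u\<close>, \<open>v\<close> and \<open>c\<close> the
    normalizing constants of the indices \<open>n\<close>, \<open>n + 1\<close>,
    \<open>n + 2\<close> are \<open>c\<close>, \<open>sqrt 2 * u * c\<close> and
    \<open>2 * u * v * c\<close>.\<close>
  define u where "u = sqrt (real (n + 1))"
  define v where "v = sqrt (real (n + 2))"
  have uv: "u > 0" "v > 0" "u * u = real (n + 1)"
    by (simp_all add: u_def v_def)
  have c1: "sqrt (2 ^ Suc n * fact (Suc n) * sqrt pi) = sqrt 2 * u * c"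
    unfolding c_def u_def by (simp flip: real_sqrt_mult add: algebra_simps)
  have c2: "sqrt (2 ^ Suc (Suc n) * fact (Suc (Suc n)) * sqrt pi) = 2 * u * v * c"
  proof -
    have "2 * u * v * c = sqrt (2 * 2 * (real (n + 1) * real (n + 2) * (2 ^ n * fact n * sqrt pi)))"
      unfolding c_def u_def v_def real_sqrt_mult by simp
    also have "2 * 2 * (real (n + 1) * real (n + 2) * (2 ^ n * fact n * sqrt pi)) =
        2 ^ Suc (Suc n) * fact (Suc (Suc n)) * sqrt pi"
      by (simp add: algebra_simps)
    finally show ?thesis by simp
  qed
  have s: "sqrt (2 / real (n + 2)) = sqrt 2 / v" "sqrt (real (n + 1) / real (n + 2)) = u / v"
    by (simp_all add: u_def v_def real_sqrt_divide)
  have "hermite_fun (Suc (Suc n)) x =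
      (2 * x * hermite (Suc n) x - 2 * (u * u) * hermite n x) * exp (- x\<^sup>2 / 2) / (2 * u * v * c)"
    unfolding hermite_fun_def c2 hermite_rec uv by simp
  also have "\<dots> = sqrt 2 / v * x * hermite_fun (Suc n) x - u / v * hermite_fun n x"
    unfolding hermite_fun_def c1 c_def[symmetric] using c uv(1,2)
    by (simp add: field_simps)
  finally show ?thesis
    unfolding s .
qed

text \<open>Both coefficients of the normalized recursion are at most 1, so one step costs at most a
  factor \<open>\<bar>x\<bar> + 1\<close>. A base depending on \<open>x\<close> is harmless, since
  the Gamma factors of the kernel absorb any geometric growth.\<close>

lemma hermite_fun_bound: "\<exists>C\<ge>0. \<forall>n. \<bar>hermite_fun n x\<bar> \<le> C * (1 + 2 * \<bar>x\<bar>) ^ n"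
proof -
  define R where "R = 1 + 2 * \<bar>x\<bar>"
  define C where "C = \<bar>hermite_fun 0 x\<bar> + \<bar>hermite_fun 1 x\<bar>"
  have R: "R \<ge> 1" and C: "C \<ge> 0"
    by (simp_all add: R_def C_def)
  have "\<bar>hermite_fun n x\<bar> \<le> C * R ^ n \<and> \<bar>hermite_fun (Suc n) x\<bar> \<le> C * R ^ Suc n" for n
  proof (induction n)
    case 0
    have "C * 1 \<le> C * R"
      using R C by (intro mult_left_mono)
    then show ?case by (simp add: C_def)
  next
    case (Suc n)
    have s1: "sqrt (2 / real (n + 2)) \<le> 1" and s2: "sqrt (real (n + 1) / real (n + 2)) \<le> 1"
      by (auto simp: field_simps)
    have "\<bar>hermite_fun (Suc (Suc n)) x\<bar> \<le>
        sqrt (2 / real (n + 2)) * (\<bar>x\<bar> * \<bar>hermite_fun (Suc n) x\<bar>) + sqrt (real (n + 1) / real (n + 2)) * \<bar>hermite_fun n x\<bar>"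
      unfolding hermite_fun_rec by (rule order_trans[OF abs_triangle_ineq4]) (simp add: abs_mult)
    also have "\<dots> \<le> 1 * (\<bar>x\<bar> * \<bar>hermite_fun (Suc n) x\<bar>) + 1 * \<bar>hermite_fun n x\<bar>"
      by (intro add_mono mult_right_mono s1 s2) auto
    also have "\<dots> \<le> \<bar>x\<bar> * (C * R ^ Suc n) + C * R ^ Suc n"
    proof -
      have "C * R ^ n \<le> C * R ^ Suc n"
        using R C by (intro mult_left_mono power_increasing) auto
      then show ?thesis
        using Suc by (auto intro!: add_mono mult_left_mono)
    qed
    also have "\<dots> = C * R ^ Suc n * (\<bar>x\<bar> + 1)"
      by (simp add: algebra_simps)
    also have "\<dots> \<le> C * R ^ Suc n * R"
      using R C by (intro mult_left_mono) (auto simp: R_def)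
    finally show ?case
      using Suc by (simp add: mult_ac)
  qed
  then show ?thesis
    using C unfolding R_def by blast
qed

subsection \<open>Orthonormal sequences in L2\<close>

text \<open>Weighted AM-GM, up to a factor 2 that is given away. Holding pointwise, it replaces the
  Cauchy-Schwarz inequality under integrals; the free weight \<open>c\<close> allows the two squares
  to be balanced differently for each term of a series.\<close>

lemma norm_mult_le_weighted_squares:
  fixes x y :: "'a::real_normed_algebra"
  assumes "c > 0"
  shows "norm (x * y) \<le> c * (norm x)\<^sup>2 + (norm y)\<^sup>2 / c"
proof -
  have "0 \<le> (c * norm x - norm y)\<^sup>2 / c"
    using assms by simp
  also have "\<dots> = c * (norm x)\<^sup>2 + (norm y)\<^sup>2 / c - 2 * (norm x * norm y)"
    using assms by (simp add: power2_eq_square field_simps)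
  finally have "norm x * norm y \<le> c * (norm x)\<^sup>2 + (norm y)\<^sup>2 / c"
    using norm_ge_zero[of x] norm_ge_zero[of y] mult_nonneg_nonneg[of "norm x" "norm y"] by linarith
  then show ?thesis
    using norm_mult_ineq order_trans by blast
qed

lemma integrable_mult_square_integrable:
  fixes f g :: "'a \<Rightarrow> 'b::{real_normed_algebra, banach, second_countable_topology}"
  assumes [measurable]: "f \<in> borel_measurable M" "g \<in> borel_measurable M"
    and "integrable M (\<lambda>x. (norm (f x))\<^sup>2)" "integrable M (\<lambda>x. (norm (g x))\<^sup>2)"
  shows "integrable M (\<lambda>x. f x * g x)"
proof (rule Bochner_Integration.integrable_bound)
  show "integrable M (\<lambda>x. (norm (f x))\<^sup>2 + (norm (g x))\<^sup>2)"
    using assms by auto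
  show "AE x in M. norm (f x * g x) \<le> norm ((norm (f x))\<^sup>2 + (norm (g x))\<^sup>2)"
    using norm_mult_le_weighted_squares[of 1] by auto
qed simp

lemma square_integrable_add:
  fixes f g :: "'a \<Rightarrow> 'b::{real_normed_vector, second_countable_topology}"
  assumes [measurable]: "f \<in> borel_measurable M" "g \<in> borel_measurable M"
    and "integrable M (\<lambda>x. (norm (f x))\<^sup>2)" "integrable M (\<lambda>x. (norm (g x))\<^sup>2)"
  shows "integrable M (\<lambda>x. (norm (f x + g x))\<^sup>2)"
proof (rule Bochner_Integration.integrable_bound)
  show "integrable M (\<lambda>x. 2 * (norm (f x))\<^sup>2 + 2 * (norm (g x))\<^sup>2)"
    using assms by auto
  have "(norm (f x + g x))\<^sup>2 \<le> 2 * (norm (f x))\<^sup>2 + 2 * (norm (g x))\<^sup>2" for x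
  proof -
    have "(norm (f x + g x))\<^sup>2 \<le> (norm (f x) + norm (g x))\<^sup>2"
      by (intro power_mono norm_triangle_ineq) simp
    also have "\<dots> \<le> 2 * (norm (f x))\<^sup>2 + 2 * (norm (g x))\<^sup>2"
      using sum_squares_bound[of "norm (f x)" "norm (g x)"] by (simp add: power2_sum)
    finally show ?thesis .
  qed
  then show "AE x in M. norm ((norm (f x + g x))\<^sup>2) \<le> norm (2 * (norm (f x))\<^sup>2 + 2 * (norm (g x))\<^sup>2)"
    by auto
qed simp

text \<open>Completeness is not part of the locale: Bessel's inequality and Riesz-Fischer hold for
  every orthonormal sequence, and they serve to exploit completeness later. The sequence is real, so
  that no conjugate appears in \<open>fourier_coeff\<close>.\<close>

locale orthonormal_sequence =
  fixes M :: "'a measure" and e :: "nat \<Rightarrow> 'a \<Rightarrow> real"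
  assumes measurable_e [measurable]: "e n \<in> borel_measurable M"
    and integrable_e: "integrable M (\<lambda>x. e n x * e m x)"
    and orthonormal: "(\<integral>x. e n x * e m x \<partial>M) = (if n = m then 1 else 0)"
begin

definition square_integrable :: "('a \<Rightarrow> complex) \<Rightarrow> bool" where
  "square_integrable f \<longleftrightarrow> f \<in> borel_measurable M \<and> integrable M (\<lambda>x. (norm (f x))\<^sup>2)"

definition fourier_coeff :: "('a \<Rightarrow> complex) \<Rightarrow> nat \<Rightarrow> complex" where
  "fourier_coeff f n = (\<integral>x. of_real (e n x) * f x \<partial>M)"

lemma square_integrable_e: "square_integrable (\<lambda>x. of_real (e n x))"
  using integrable_e[of n n] by (simp add: square_integrable_def power2_eq_square)

lemma square_integrable_cmult: "square_integrable f \<Longrightarrow> square_integrable (\<lambda>x. c * f x)"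
  by (simp add: square_integrable_def norm_mult power_mult_distrib borel_measurable_times)

lemma square_integrable_plus:
  "square_integrable f \<Longrightarrow> square_integrable g \<Longrightarrow> square_integrable (\<lambda>x. f x + g x)"
  by (simp add: square_integrable_def square_integrable_add borel_measurable_add)

lemma square_integrable_diff:
  "square_integrable f \<Longrightarrow> square_integrable g \<Longrightarrow> square_integrable (\<lambda>x. f x - g x)"
  using square_integrable_plus[of f "\<lambda>x. -1 * g x"] square_integrable_cmult[of g "-1"] by simp

lemma square_integrable_sum:
  "(\<And>i. i \<in> I \<Longrightarrow> square_integrable (f i)) \<Longrightarrow> square_integrable (\<lambda>x. \<Sum>i\<in>I. f i x)"
proof (induction I rule: infinite_finite_induct)
  case (insert i I)
  then show ?case using square_integrable_plus[of "f i" "\<lambda>x. \<Sum>i\<in>I. f i x"] by auto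
qed (simp_all add: square_integrable_def)

lemma integrable_e_mult: "square_integrable f \<Longrightarrow> integrable M (\<lambda>x. of_real (e n x) * f x)"
  using square_integrable_e[of n] unfolding square_integrable_def
  by (auto intro: integrable_mult_square_integrable)

lemma fourier_coeff_diff:
  "square_integrable f \<Longrightarrow> square_integrable g \<Longrightarrow>
    fourier_coeff (\<lambda>x. f x - g x) n = fourier_coeff f n - fourier_coeff g n"
  by (simp add: fourier_coeff_def right_diff_distrib integrable_e_mult)

text \<open>The index set is arbitrary because blocks of consecutive indices are needed as well as
  initial segments.\<close>

definition partial :: "(nat \<Rightarrow> complex) \<Rightarrow> nat set \<Rightarrow> 'a \<Rightarrow> complex" where
  "partial a I x = (\<Sum>n\<in>I. a n * of_real (e n x))"

lemma square_integrable_partial: "square_integrable (partial a I)"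
  unfolding partial_def[abs_def]
  by (intro square_integrable_sum square_integrable_cmult square_integrable_e)

lemma fourier_coeff_partial:
  assumes "finite I"
  shows "fourier_coeff (partial a I) n = (if n \<in> I then a n else 0)"
proof -
  have i: "integrable M (\<lambda>x. a m * complex_of_real (e n x * e m x))" for m
    using integrable_e by (intro integrable_mult_right) (simp only: integrable_of_real)
  have "fourier_coeff (partial a I) n = (\<integral>x. (\<Sum>m\<in>I. a m * complex_of_real (e n x * e m x)) \<partial>M)"
    unfolding fourier_coeff_def partial_def by (simp add: sum_distrib_left mult_ac)
  also have "\<dots> = (\<Sum>m\<in>I. a m * complex_of_real (\<integral>x. e n x * e m x \<partial>M))"
    by (subst Bochner_Integration.integral_sum[OF i])
      (simp only: integral_mult_right_zero integral_complex_of_real)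
  also have "\<dots> = (\<Sum>m\<in>I. if m = n then a m else 0)"
    unfolding orthonormal by (intro sum.cong) auto
  also have "\<dots> = (if n \<in> I then a n else 0)"
    using assms by simp
  finally show ?thesis .
qed

lemma integral_mult_cnj_partial:
  assumes "square_integrable f"
  shows "(\<integral>x. f x * cnj (partial a I x) \<partial>M) = (\<Sum>n\<in>I. cnj (a n) * fourier_coeff f n)"
proof -
  have "(\<integral>x. f x * cnj (partial a I x) \<partial>M) = (\<integral>x. (\<Sum>n\<in>I. cnj (a n) * (of_real (e n x) * f x)) \<partial>M)"
    unfolding partial_def by (simp add: sum_distrib_left mult_ac)
  also have "\<dots> = (\<Sum>n\<in>I. cnj (a n) * (\<integral>x. of_real (e n x) * f x \<partial>M))"
    using integrable_e_mult[OF assms]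
    by (subst Bochner_Integration.integral_sum) auto
  finally show ?thesis
    unfolding fourier_coeff_def .
qed

lemma integral_norm_partial:
  assumes "finite I"
  shows "(\<integral>x. (norm (partial a I x))\<^sup>2 \<partial>M) = (\<Sum>n\<in>I. (norm (a n))\<^sup>2)"
proof -
  have "complex_of_real (\<integral>x. (norm (partial a I x))\<^sup>2 \<partial>M) = (\<integral>x. partial a I x * cnj (partial a I x) \<partial>M)"
    by (simp only: integral_complex_of_real[symmetric] complex_norm_square)
  also have "\<dots> = (\<Sum>n\<in>I. cnj (a n) * a n)"
    unfolding integral_mult_cnj_partial[OF square_integrable_partial]
    by (intro sum.cong) (simp_all add: fourier_coeff_partial assms)
  also have "\<dots> = complex_of_real (\<Sum>n\<in>I. (norm (a n))\<^sup>2)"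
    by (simp add: mult.commute flip: complex_norm_square)
  finally show ?thesis
    by (simp only: of_real_eq_iff)
qed

text \<open>The squared norm of \<open>f\<close> minus its partial Fourier sum is nonnegative. In
  its expansion the cross term and the norm of the partial sum both reduce to the sum of the squared
  coefficients.\<close>

lemma bessel_finite:
  assumes f: "square_integrable f" and "finite I"
  shows "(\<Sum>n\<in>I. (norm (fourier_coeff f n))\<^sup>2) \<le> (\<integral>x. (norm (f x))\<^sup>2 \<partial>M)"
proof -
  define a where "a = fourier_coeff f"
  let ?S = "partial a I"
  have S: "square_integrable ?S"
    by (rule square_integrable_partial)
  have i: "integrable M (\<lambda>x. f x * cnj (?S x))"
    using f S by (intro integrable_mult_square_integrable)
      (auto simp: square_integrable_def intro: measurable_compose[OF _ borel_measurable_continuous_onI[OF continuous_on_cnj[OF continuous_on_id]]])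
  define r where "r = (\<lambda>x. Re (f x * cnj (?S x)))"
  have r: "integrable M r" "integral\<^sup>L M r = Re (\<integral>x. f x * cnj (?S x) \<partial>M)"
    unfolding r_def using integrable_Re[OF i] integral_Re[OF i] by simp_all
  have eq: "(norm (f x - ?S x))\<^sup>2 = (norm (f x))\<^sup>2 + (norm (?S x))\<^sup>2 - 2 * r x" for x
    unfolding cmod_power2 r_def by (simp add: power2_eq_square algebra_simps)
  have "0 \<le> (\<integral>x. (norm (f x - ?S x))\<^sup>2 \<partial>M)"
    by simp
  also have "\<dots> = (\<integral>x. (norm (f x))\<^sup>2 \<partial>M) + (\<integral>x. (norm (?S x))\<^sup>2 \<partial>M) - 2 * integral\<^sup>L M r"
    unfolding eq using f S r(1) by (simp add: square_integrable_def)
  also note r(2)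
  also have "(\<integral>x. f x * cnj (?S x) \<partial>M) = (\<Sum>n\<in>I. cnj (a n) * a n)"
    unfolding integral_mult_cnj_partial[OF f] by (simp add: a_def)
  also have "Re \<dots> = (\<Sum>n\<in>I. (norm (a n))\<^sup>2)"
    unfolding cmod_power2 by (simp add: power2_eq_square)
  finally show ?thesis
    by (simp add: integral_norm_partial[OF assms(2)] a_def)
qed

lemma bessel:
  assumes "square_integrable f"
  shows "summable (\<lambda>n. (norm (fourier_coeff f n))\<^sup>2)"
  using bessel_finite[OF assms] by (intro summableI_nonneg_bounded) auto

text \<open>The partial sums along a subsequence whose tails decay like \<open>4 ^ (- k)\<close> converge almost
  everywhere; the weights \<open>2 ^ k\<close> turn the Cauchy-Schwarz inequality into pointwise AM-GM.\<close>

theorem riesz_fischer: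
  assumes a: "summable (\<lambda>n. (norm (a n))\<^sup>2)"
  obtains f where "square_integrable f" "\<And>n. fourier_coeff f n = a n"
    "(\<integral>x. (norm (f x))\<^sup>2 \<partial>M) = (\<Sum>n. (norm (a n))\<^sup>2)"
proof -
  have "\<exists>N. \<forall>m\<ge>N. \<forall>n. norm (\<Sum>i=m..<n. (norm (a i))\<^sup>2) < (1/4) ^ k" for k :: nat
    using a unfolding summable_Cauchy by auto
  then obtain N where N: "\<And>k m n. m \<ge> N k \<Longrightarrow> norm (\<Sum>i=m..<n. (norm (a i))\<^sup>2) < (1/4) ^ k"
    by metis
  \<comment> \<open>Block boundaries. Summing the successors of the Cauchy thresholds makes
    \<open>K\<close> strictly increasing and places each \<open>K (Suc j)\<close> beyond
    \<open>N (Suc j)\<close>; \<open>K 0 = 0\<close> lets the first block start with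
    \<open>a 0\<close>.\<close>
  define K where "K = (\<lambda>k. (case k of 0 \<Rightarrow> 0 | Suc j \<Rightarrow> (\<Sum>i\<le>j. Suc (N (Suc i)))))"
  have K0: "K 0 = 0"
    by (simp add: K_def)
  have Kmono: "K k < K (Suc k)" for k
    by (cases k) (simp_all add: K_def)
  have KN: "N (Suc k) \<le> K (Suc k)" for k
    by (cases k) (simp_all add: K_def)
  have Kge: "n \<le> K n" for n
    by (rule seq_suble) (use Kmono in \<open>simp add: strict_mono_Suc_iff\<close>)
  define g where "g = (\<lambda>k. partial a {K k..<K (Suc k)})"
  have gsum: "(\<Sum>k<n. g k x) = partial a {..<K n} x" for n x
  proof (induction n)
    case 0
    then show ?case by (simp add: K0 partial_def)
  next
    case (Suc n)
    have "partial a {..<K (Suc n)} x = partial a {..<K n} x + partial a {K n..<K (Suc n)} x"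
      unfolding partial_def lessThan_atLeast0
      by (rule sum.atLeastLessThan_concat[symmetric]) (use Kmono[of n] in simp_all)
    then show ?case
      using Suc by (simp add: g_def)
  qed
  have g: "square_integrable (g k)" for k
    unfolding g_def by (rule square_integrable_partial)
  then have [measurable]: "g k \<in> borel_measurable M" for k
    by (simp add: square_integrable_def)
  have gint: "integrable M (\<lambda>x. (norm (g k x))\<^sup>2)" for k
    using g by (simp add: square_integrable_def)
  define S where "S = (\<Sum>n. (norm (a n))\<^sup>2)"
  \<comment> \<open>The block of index 0 starts below every threshold and is bounded only by the
    whole sum \<open>S\<close>; the factor \<open>S + 1\<close> covers it together with the small
    blocks.\<close>
  have gnorm: "(\<integral>x. (norm (g k x))\<^sup>2 \<partial>M) \<le> (S + 1) * (1/4) ^ k" for k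
  proof (cases k)
    case 0
    have "(\<Sum>n\<in>{K 0..<K (Suc 0)}. (norm (a n))\<^sup>2) \<le> S"
      unfolding S_def using a by (intro sum_le_suminf) auto
    then show ?thesis
      by (simp add: 0 g_def integral_norm_partial)
  next
    case (Suc j)
    have "(\<Sum>n\<in>{K k..<K (Suc k)}. (norm (a n))\<^sup>2) \<le> (1/4) ^ k"
      using N[of k "K k" "K (Suc k)"] KN[of j] Suc by (simp add: sum_nonneg)
    also have "\<dots> \<le> (S + 1) * (1/4) ^ k"
      using suminf_nonneg[OF a] by (simp add: S_def)
    finally show ?thesis
      by (simp add: g_def integral_norm_partial)
  qed
  let ?w = "\<lambda>k x. 2 ^ k * (norm (g k x))\<^sup>2"
  have wsum: "summable (\<lambda>k. \<integral>x. norm (?w k x) \<partial>M)"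
  proof (rule summable_comparison_test)
    show "summable (\<lambda>k. (S + 1) * (1/2) ^ k)"
      by (intro summable_mult summable_geometric) auto
    have "norm (\<integral>x. norm (?w k x) \<partial>M) \<le> (S + 1) * (1/2) ^ k" for k
    proof -
      have "norm (\<integral>x. norm (?w k x) \<partial>M) = 2 ^ k * (\<integral>x. (norm (g k x))\<^sup>2 \<partial>M)"
        by simp
      also have "\<dots> \<le> 2 ^ k * ((S + 1) * (1/4) ^ k)"
        by (intro mult_left_mono gnorm) auto
      also have "\<dots> = (S + 1) * (2 ^ k * (1/4) ^ k)"
        by simp
      also have "2 ^ k * (1/4) ^ k = ((1/2)::real) ^ k"
        by (simp flip: power_mult_distrib)
      finally show ?thesis .
    qed
    then show "\<exists>N. \<forall>n\<ge>N. norm (\<integral>x. norm (?w n x) \<partial>M) \<le> (S + 1) * (1/2) ^ n"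
      by blast
  qed
  have wint: "integrable M (?w k)" for k
    using gint by simp
  have wAE: "AE x in M. summable (\<lambda>k. norm (?w k x))"
  proof -
    have "(\<integral>\<^sup>+x. (\<Sum>k. ennreal (?w k x)) \<partial>M) = (\<Sum>k. \<integral>\<^sup>+x. ennreal (?w k x) \<partial>M)"
      by (rule nn_integral_suminf) simp
    also have "\<dots> = (\<Sum>k. ennreal (\<integral>x. norm (?w k x) \<partial>M))"
      by (intro suminf_cong) (subst nn_integral_eq_integral[OF wint], auto)
    also have "\<dots> < \<infinity>"
      using wsum by (subst suminf_ennreal2) auto
    finally have "AE x in M. (\<Sum>k. ennreal (?w k x)) \<noteq> \<infinity>"
      by (intro nn_integral_PInf_AE) auto
    then show ?thesis
    proof eventually_elim
      case (elim x)
      then have "summable (\<lambda>k. ?w k x)"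
        by (intro summable_suminf_not_top) auto
      then show ?case by simp
    qed
  qed
  have gAE: "AE x in M. summable (\<lambda>k. norm (g k x))"
    using wAE
  proof eventually_elim
    case (elim x)
    show ?case
    proof (rule summable_comparison_test)
      show "summable (\<lambda>k. ?w k x + (1/2) ^ k)"
        using elim by (intro summable_add summable_geometric) auto
      have "norm (norm (g k x)) \<le> ?w k x + (1/2) ^ k" for k
        using norm_mult_le_weighted_squares[of "2 ^ k" "g k x" 1] by (simp add: power_divide)
      then show "\<exists>N. \<forall>n\<ge>N. norm (norm (g n x)) \<le> ?w n x + (1/2) ^ n"
        by blast
    qed
  qed
  define f where "f = (\<lambda>x. \<Sum>k. g k x)"
  have fm [measurable]: "f \<in> borel_measurable M"
    unfolding f_def by measurable
  have lim: "AE x in M. (\<lambda>n. partial a {..<K n} x) \<longlonglongrightarrow> f x"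
    using gAE
  proof eventually_elim
    case (elim x)
    then have "(\<lambda>k. g k x) sums f x"
      unfolding f_def by (rule summable_sums[OF summable_norm_cancel])
    then show ?case
      by (simp add: sums_def gsum)
  qed
  \<comment> \<open>Fatou's lemma along the subsequence gives the upper bound for the norm. The
    reverse inequality comes from Bessel once the coefficients of \<open>f\<close> are
    known.\<close>
  have fbound: "(\<integral>\<^sup>+x. ennreal ((norm (f x))\<^sup>2) \<partial>M) \<le> ennreal S"
  proof -
    have pm [measurable]: "partial a I \<in> borel_measurable M" for I
      using square_integrable_partial[of a I] by (simp add: square_integrable_def)
    have "(\<integral>\<^sup>+x. ennreal ((norm (f x))\<^sup>2) \<partial>M) =
        (\<integral>\<^sup>+x. liminf (\<lambda>n. ennreal ((norm (partial a {..<K n} x))\<^sup>2)) \<partial>M)"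
    proof (rule nn_integral_cong_AE)
      show "AE x in M. ennreal ((norm (f x))\<^sup>2) = liminf (\<lambda>n. ennreal ((norm (partial a {..<K n} x))\<^sup>2))"
        using lim
      proof eventually_elim
        case (elim x)
        have "(\<lambda>n. ennreal ((norm (partial a {..<K n} x))\<^sup>2)) \<longlonglongrightarrow> ennreal ((norm (f x))\<^sup>2)"
          using elim by (intro tendsto_ennrealI tendsto_power tendsto_norm)
        then show ?case
          by (simp only: lim_imp_Liminf[OF sequentially_bot])
      qed
    qed
    also have "\<dots> \<le> liminf (\<lambda>n. \<integral>\<^sup>+x. ennreal ((norm (partial a {..<K n} x))\<^sup>2) \<partial>M)"
      by (intro nn_integral_liminf) simp
    also have "\<dots> = liminf (\<lambda>n. ennreal (\<Sum>i<K n. (norm (a i))\<^sup>2))"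
    proof -
      have "(\<integral>\<^sup>+x. ennreal ((norm (partial a {..<K n} x))\<^sup>2) \<partial>M) = ennreal (\<Sum>i<K n. (norm (a i))\<^sup>2)" for n
        using square_integrable_partial[of a "{..<K n}"] integral_norm_partial[of "{..<K n}" a]
        by (subst nn_integral_eq_integral) (auto simp: square_integrable_def)
      then show ?thesis by simp
    qed
    also have "\<dots> \<le> liminf (\<lambda>n. ennreal S)"
      unfolding S_def using a
      by (intro Liminf_mono always_eventually allI ennreal_leI sum_le_suminf) auto
    finally show ?thesis by (simp add: Liminf_const)
  qed
  have fi: "integrable M (\<lambda>x. (norm (f x))\<^sup>2)"
    using fbound by (intro integrableI_bounded) (auto simp: top_unique[symmetric] less_top intro: le_less_trans)
  have f: "square_integrable f"
    using fi by (simp add: square_integrable_def)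
  have coeff: "fourier_coeff f n = a n" for n
  proof -
    let ?h = "\<lambda>k x. of_real (e n x) * g k x"
    have hi: "integrable M (?h k)" for k
      by (rule integrable_e_mult[OF g])
    have hb: "norm (?h k x) \<le> ?w k x + (e n x)\<^sup>2 * (1/2) ^ k" for k x
      using norm_mult_le_weighted_squares[of "2 ^ k" "g k x" "of_real (e n x)"]
      by (simp add: norm_mult mult_ac power_divide)
    have "(\<lambda>k. \<integral>x. ?h k x \<partial>M) sums (\<integral>x. (\<Sum>k. ?h k x) \<partial>M)"
    proof (rule sums_integral[OF hi])
      show "AE x in M. summable (\<lambda>k. norm (?h k x))"
        using gAE by eventually_elim (simp add: norm_mult summable_mult)
      show "summable (\<lambda>k. \<integral>x. norm (?h k x) \<partial>M)"
      proof (rule summable_comparison_test)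
        show "summable (\<lambda>k. (\<integral>x. norm (?w k x) \<partial>M) + (1/2) ^ k)"
          using wsum by (intro summable_add summable_geometric) auto
        have "norm (\<integral>x. norm (?h k x) \<partial>M) \<le> (\<integral>x. norm (?w k x) \<partial>M) + (1/2) ^ k" for k
        proof -
          have ei: "integrable M (\<lambda>x. (e n x)\<^sup>2)"
            using integrable_e[of n n] by (simp add: power2_eq_square)
          have "norm (\<integral>x. norm (?h k x) \<partial>M) = (\<integral>x. norm (?h k x) \<partial>M)"
            by simp
          also have "\<dots> \<le> (\<integral>x. ?w k x + (e n x)\<^sup>2 * (1/2) ^ k \<partial>M)"
            using hi wint ei hb by (intro integral_mono) auto
          also have "\<dots> = (\<integral>x. ?w k x \<partial>M) + (\<integral>x. (e n x)\<^sup>2 \<partial>M) * (1/2) ^ k"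
            using wint ei by simp
          also have "(\<integral>x. (e n x)\<^sup>2 \<partial>M) = 1"
            using orthonormal[of n n] by (simp add: power2_eq_square)
          finally show ?thesis by simp
        qed
        then show "\<exists>N. \<forall>k\<ge>N. norm (\<integral>x. norm (?h k x) \<partial>M) \<le> (\<integral>x. norm (?w k x) \<partial>M) + (1/2) ^ k"
          by blast
      qed
    qed
    also have "(\<integral>x. (\<Sum>k. ?h k x) \<partial>M) = fourier_coeff f n"
      unfolding fourier_coeff_def
    proof (rule integral_cong_AE)
      show "AE x in M. (\<Sum>k. ?h k x) = complex_of_real (e n x) * f x"
        using gAE by eventually_elim (simp add: f_def suminf_mult summable_norm_cancel)
    qed auto
    finally have "(\<lambda>m. \<Sum>k<m. fourier_coeff (g k) n) \<longlonglongrightarrow> fourier_coeff f n"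
      by (simp add: sums_def fourier_coeff_def)
    \<comment> \<open>As \<open>m \<le> K m\<close>, the index \<open>n\<close> belongs to the first
      \<open>m\<close> blocks as soon as \<open>m > n\<close>; from there on the sequence is
      constant.\<close>
    moreover have "(\<Sum>k<m. fourier_coeff (g k) n) = a n" if "m \<ge> Suc n" for m
    proof -
      have "(\<Sum>k<m. fourier_coeff (g k) n) = (\<integral>x. (\<Sum>k<m. ?h k x) \<partial>M)"
        unfolding fourier_coeff_def by (rule Bochner_Integration.integral_sum[OF hi, symmetric])
      also have "\<dots> = fourier_coeff (partial a {..<K m}) n"
        unfolding fourier_coeff_def by (simp add: gsum flip: sum_distrib_left)
      also have "\<dots> = a n"
        using Kge[of m] that by (subst fourier_coeff_partial) auto
      finally show ?thesis .
    qed
    then have "(\<lambda>m. \<Sum>k<m. fourier_coeff (g k) n) \<longlonglongrightarrow> a n"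
      by (intro tendsto_eventually) (auto simp: eventually_sequentially)
    ultimately show ?thesis
      by (rule LIMSEQ_unique)
  qed
  have "(\<integral>x. (norm (f x))\<^sup>2 \<partial>M) \<le> S"
  proof -
    have "S \<ge> 0"
      unfolding S_def by (rule suminf_nonneg[OF a]) simp
    then show ?thesis
      using fbound nn_integral_eq_integral[OF fi] by simp
  qed
  moreover have "S \<le> (\<integral>x. (norm (f x))\<^sup>2 \<partial>M)"
    unfolding S_def using bessel_finite[OF f] a by (intro suminf_le_const) (auto simp: coeff)
  ultimately show ?thesis
    using that[OF f coeff] by (simp add: S_def)
qed

end

subsection \<open>Completeness of the Hermite functions\<close>

text \<open>The positive part \<open>p 1\<close> and the negative part \<open>p (-1)\<close> of
  \<open>g\<close> have equal transforms; at \<open>t = 0\<close> this says that they have the same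
  mass \<open>m\<close>. If \<open>m > 0\<close>, division by \<open>m\<close> makes them densities
  of probability measures with equal characteristic functions; if \<open>m = 0\<close>, both vanish
  almost everywhere.\<close>

lemma fourier_transform_zero_imp_AE_zero:
  fixes g :: "real \<Rightarrow> real"
  assumes g: "integrable lborel g"
    and zero: "\<And>t. (\<integral>x. iexp (t * x) * complex_of_real (g x) \<partial>lborel) = 0"
  shows "AE x in lborel. g x = 0"
proof -
  define p where "p = (\<lambda>s x. max 0 (s * g x))"
  have gm [measurable]: "g \<in> borel_measurable borel"
    using g by auto
  have pm [measurable]: "p s \<in> borel_measurable borel" for s
    unfolding p_def by measurable
  have pn: "p s x \<ge> 0" for s x
    by (simp add: p_def)
  have pint: "integrable lborel (p s)" for s
    unfolding p_def by (intro integrable_max integrable_mult_right g) auto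
  have pd: "g x = p 1 x - p (-1) x" for x
    by (auto simp: p_def max_def)
  have ci: "integrable lborel (\<lambda>x. p s x *\<^sub>R iexp (t * x))" for s t
  proof (rule Bochner_Integration.integrable_bound[OF pint[of s]])
    show "AE x in lborel. norm (p s x *\<^sub>R iexp (t * x)) \<le> norm (p s x)"
      by (simp add: norm_mult)
  qed simp
  have peq: "(\<integral>x. p 1 x *\<^sub>R iexp (t * x) \<partial>lborel) = (\<integral>x. p (-1) x *\<^sub>R iexp (t * x) \<partial>lborel)" for t
  proof -
    have "(\<integral>x. p 1 x *\<^sub>R iexp (t * x) \<partial>lborel) - (\<integral>x. p (-1) x *\<^sub>R iexp (t * x) \<partial>lborel) =
        (\<integral>x. iexp (t * x) * complex_of_real (g x) \<partial>lborel)"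
      unfolding Bochner_Integration.integral_diff[OF ci ci, symmetric]
      by (intro Bochner_Integration.integral_cong refl) (simp add: pd scaleR_conv_of_real algebra_simps)
    then show ?thesis
      using zero by simp
  qed
  define m where "m = (\<integral>x. p 1 x \<partial>lborel)"
  have m2: "(\<integral>x. p s x \<partial>lborel) = m" if "s \<in> {1, -1}" for s
  proof -
    have "complex_of_real (\<integral>x. p 1 x \<partial>lborel) = complex_of_real (\<integral>x. p (-1) x \<partial>lborel)"
      using peq[of 0] by (simp add: scaleR_conv_of_real)
    then show ?thesis
      using that by (auto simp: m_def)
  qed
  have "m \<ge> 0"
    unfolding m_def using pn by (intro integral_nonneg_AE) auto
  show ?thesis
  proof (cases "m = 0")
    case True
    have "AE x in lborel. p s x = 0" if "s \<in> {1, -1}" for s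
      using integral_nonneg_eq_0_iff_AE[OF pint[of s]] pn m2[OF that] True by auto
    from this[of 1] this[of "-1"] show ?thesis
      by (auto simp: pd)
  next
    case False
    with \<open>m \<ge> 0\<close> have m: "m > 0"
      by simp
    define M where "M = (\<lambda>s. density lborel (\<lambda>x. ennreal (p s x / m)))"
    have prob: "prob_space (M s)" if "s \<in> {1, -1}" for s
    proof
      have "emeasure (M s) (space (M s)) = (\<integral>\<^sup>+x. ennreal (p s x / m) \<partial>lborel)"
        by (simp add: M_def emeasure_density)
      also have "\<dots> = ennreal (\<integral>x. p s x / m \<partial>lborel)"
        using pn m by (intro nn_integral_eq_integral integrable_divide pint) auto
      also have "\<dots> = 1"
        using m2[OF that] m by simp
      finally show "emeasure (M s) (space (M s)) = 1" .
    qed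
    have dist: "real_distribution (M s)" if "s \<in> {1, -1}" for s
      using prob[OF that] by (intro real_distribution.intro real_distribution_axioms.intro) (auto simp: M_def)
    have "char (M s) t = (\<integral>x. p s x *\<^sub>R iexp (t * x) \<partial>lborel) / complex_of_real m" for s t
    proof -
      have "char (M s) t = (\<integral>x. (p s x / m) *\<^sub>R iexp (t * x) \<partial>lborel)"
        unfolding char_def M_def using pn m by (intro integral_density) auto
      also have "\<dots> = (\<integral>x. (p s x *\<^sub>R iexp (t * x)) / complex_of_real m \<partial>lborel)"
        by (simp add: scaleR_conv_of_real)
      finally show ?thesis
        by simp
    qed
    then have "char (M 1) = char (M (-1))"
      using peq by auto
    then have "M 1 = M (-1)"
      using dist by (intro Levy_uniqueness) auto
    then have "AE x in lborel. ennreal (p 1 x / m) = ennreal (p (-1) x / m)"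
      unfolding M_def by (subst (asm) sigma_finite_measure.density_unique_iff[OF sigma_finite_lborel]) auto
    then show ?thesis
      by eventually_elim (use m pn in \<open>simp add: pd\<close>)
  qed
qed

lemma square_integrable_poly_gaussian:
  "integrable lborel (\<lambda>x::real. (norm (poly p x * exp (- x\<^sup>2 / 2)))\<^sup>2)"
proof -
  have "(norm (poly p x * exp (- x\<^sup>2 / 2)))\<^sup>2 = poly (p\<^sup>2) x * exp (- x\<^sup>2)" for x :: real
    by (simp add: power_mult_distrib flip: exp_double)
  then show ?thesis
    using integrable_poly_gaussian by presburger
qed

lemma integrable_poly_gaussian_mult:
  assumes "u \<in> borel_measurable borel" "integrable lborel (\<lambda>x. (u x)\<^sup>2)"
  shows "integrable lborel (\<lambda>x::real. poly p x * exp (- x\<^sup>2 / 2) * u x)"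
  using assms
  by (intro integrable_mult_square_integrable square_integrable_poly_gaussian)
    (auto intro!: borel_measurable_continuous_onI continuous_intros)

text \<open>The three-term recurrence solved for the product with \<open>X\<close>; index 0 stands
  apart because it has no predecessor.\<close>

lemma X_mult_hermite_poly:
  "[:0, 1:] * hermite_poly 0 = smult (1/2) (hermite_poly 1)"
  "[:0, 1:] * hermite_poly (Suc n) = smult (1/2) (hermite_poly (Suc (Suc n))) + smult (real (Suc n)) (hermite_poly n)"
  unfolding hermite_poly.simps(2)[of "Suc n"] pderiv_hermite_poly
  by (simp_all add: smult_diff_right add_divide_distrib del: hermite_poly.simps(2)) simp

lemma hermite_moments_zero:
  fixes u :: "real \<Rightarrow> real"
  assumes u: "u \<in> borel_measurable borel" "integrable lborel (\<lambda>x. (u x)\<^sup>2)"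
    and zero: "\<And>n. (\<integral>x. hermite_fun n x * u x \<partial>lborel) = 0"
  shows "(\<integral>x. x ^ k * exp (- x\<^sup>2 / 2) * u x \<partial>lborel) = 0"
proof -
  define L where "L = (\<lambda>p. \<integral>x. poly p x * exp (- x\<^sup>2 / 2) * u x \<partial>lborel)"
  have L_smult: "L (smult c p) = c * L p" for c p
    unfolding L_def by (simp add: mult.assoc)
  have L_add: "L (p + q) = L p + L q" for p q
    unfolding L_def using integrable_poly_gaussian_mult[OF u] by (simp add: distrib_right)
  \<comment> \<open>All \<open>n\<close> are treated at once because trading a factor
    \<open>X\<close> for Hermite polynomials shifts the index up and down. The monomials are the
    case \<open>n = 0\<close>.\<close>
  have "L ([:0, 1:] ^ k * hermite_poly n) = 0" for n
  proof (induction k arbitrary: n)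
    case 0
    define c where "c = sqrt (2 ^ n * fact n * sqrt pi)"
    have "c > 0"
      by (simp add: c_def)
    then have eq: "poly (hermite_poly n) x * exp (- x\<^sup>2 / 2) * u x = c * (hermite_fun n x * u x)" for x
      by (simp add: hermite_fun_def hermite_eq_poly flip: c_def)
    show ?case
      unfolding L_def power_0 mult_1 eq using zero by simp
  next
    case (Suc k)
    have "[:0, 1:] ^ Suc k * hermite_poly n = [:0, 1:] ^ k * ([:0, 1:] * hermite_poly n)"
      by (simp only: power_Suc mult_ac)
    then show ?case
      using Suc
      by (cases n) (simp_all only: X_mult_hermite_poly distrib_left mult_smult_right L_add L_smult mult_zero_right add_0)
  qed
  from this[of 0] show ?thesis
    by (simp add: L_def)
qed

text \<open>The vanishing moments are used through the exponential series: every partial sum of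
  \<open>iexp (t * x)\<close> integrates to 0 against the Gaussian times \<open>u\<close>, and
  dominated convergence passes to the limit. The majorant \<open>?w\<close> is integrable as a
  product of two square integrable functions.\<close>

lemma hermite_fun_complete_real:
  fixes u :: "real \<Rightarrow> real"
  assumes u [measurable]: "u \<in> borel_measurable borel" and u2: "integrable lborel (\<lambda>x. (u x)\<^sup>2)"
    and zero: "\<And>n. (\<integral>x. hermite_fun n x * u x \<partial>lborel) = 0"
  shows "AE x in lborel. u x = 0"
proof -
  let ?g = "\<lambda>x. exp (- x\<^sup>2 / 2) * u x"
  have gi: "integrable lborel ?g"
    using integrable_poly_gaussian_mult[OF u u2, of 1] by simp
  have "(\<integral>x. iexp (t * x) * complex_of_real (?g x) \<partial>lborel) = 0" for t
  proof -
    let ?s = "\<lambda>N x. (\<Sum>n<N. (\<i> * complex_of_real (t * x)) ^ n /\<^sub>R fact n) * complex_of_real (?g x)"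
    let ?w = "\<lambda>x. exp (\<bar>t\<bar> * \<bar>x\<bar>) * exp (- x\<^sup>2 / 2) * u x"
    have "(\<lambda>N. \<integral>x. ?s N x \<partial>lborel) \<longlonglongrightarrow> (\<integral>x. iexp (t * x) * complex_of_real (?g x) \<partial>lborel)"
    proof (rule integral_dominated_convergence)
      show "integrable lborel (\<lambda>x. norm (?w x))"
      proof (intro integrable_norm integrable_mult_square_integrable)
        show "integrable lborel (\<lambda>x. (norm (exp (\<bar>t\<bar> * \<bar>x\<bar>) * exp (- x\<^sup>2 / 2)))\<^sup>2)"
        proof (rule Bochner_Integration.integrable_bound)
          show "integrable lborel (\<lambda>x. exp (2 * t\<^sup>2) * (sqrt (2 * pi) * normal_density 0 1 x))"
            by (intro integrable_mult_right integrable_normal_density) simp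
          have "(norm (exp (\<bar>t\<bar> * \<bar>x\<bar>) * exp (- x\<^sup>2 / 2)))\<^sup>2 \<le> exp (2 * t\<^sup>2) * (sqrt (2 * pi) * normal_density 0 1 x)" for x
          proof -
            \<comment> \<open>Completing the square trades half of the Gaussian decay for the factor
              \<open>exp (2 * t^2)\<close>; the remaining half is a multiple of the standard normal
              density.\<close>
            have "0 \<le> (2 * \<bar>t\<bar> - \<bar>x\<bar>)\<^sup>2"
              by simp
            then have "2 * (\<bar>t\<bar> * \<bar>x\<bar>) - x\<^sup>2 \<le> 2 * t\<^sup>2 - x\<^sup>2 / 2"
              by (simp add: power2_diff power_mult_distrib)
            then have "exp (2 * (\<bar>t\<bar> * \<bar>x\<bar>) - x\<^sup>2) \<le> exp (2 * t\<^sup>2) * exp (- x\<^sup>2 / 2)"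
              by (simp flip: exp_add)
            moreover have "(norm (exp (\<bar>t\<bar> * \<bar>x\<bar>) * exp (- x\<^sup>2 / 2)))\<^sup>2 = exp (2 * (\<bar>t\<bar> * \<bar>x\<bar>) - x\<^sup>2)"
              by (simp flip: exp_add exp_double)
            ultimately show ?thesis
              by (simp add: normal_density_def)
          qed
          then show "AE x in lborel. norm ((norm (exp (\<bar>t\<bar> * \<bar>x\<bar>) * exp (- x\<^sup>2 / 2)))\<^sup>2) \<le>
              norm (exp (2 * t\<^sup>2) * (sqrt (2 * pi) * normal_density 0 1 x))"
            by auto
        qed simp
      qed (use u2 in simp_all)
      show "AE x in lborel. (\<lambda>N. ?s N x) \<longlonglongrightarrow> iexp (t * x) * complex_of_real (?g x)"
        using exp_converges[of "\<i> * complex_of_real (t * x)" for x]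
        by (auto simp: sums_def intro!: tendsto_mult)
      show "AE x in lborel. norm (?s N x) \<le> norm (?w x)" for N
      proof (rule AE_I2)
        fix x
        have "norm (\<Sum>n<N. (\<i> * complex_of_real (t * x)) ^ n /\<^sub>R fact n) \<le>
            (\<Sum>n<N. (\<bar>t\<bar> * \<bar>x\<bar>) ^ n /\<^sub>R fact n)"
          by (rule order_trans[OF norm_sum]) (simp add: norm_mult norm_power norm_divide abs_mult)
        also have "\<dots> \<le> exp (\<bar>t\<bar> * \<bar>x\<bar>)"
          unfolding exp_def by (intro sum_le_suminf summable_exp_generic) auto
        finally show "norm (?s N x) \<le> norm (?w x)"
          by (simp add: norm_mult abs_mult mult.assoc mult_right_mono)
      qed
    qed auto
    moreover have "(\<integral>x. ?s N x \<partial>lborel) = 0" for N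
    proof -
      have "?s N x = (\<Sum>n<N. (\<i> * complex_of_real t) ^ n / fact n * complex_of_real (x ^ n * exp (- x\<^sup>2 / 2) * u x))" for x
        unfolding sum_distrib_right
        by (intro sum.cong refl) (simp add: power_mult_distrib scaleR_conv_of_real field_simps)
      moreover have "integrable lborel (\<lambda>x. x ^ n * exp (- x\<^sup>2 / 2) * u x)" for n
        using integrable_poly_gaussian_mult[OF u u2, of "monom 1 n"] by (simp add: poly_monom)
      then have "integrable lborel (\<lambda>x. (\<i> * complex_of_real t) ^ n / fact n * complex_of_real (x ^ n * exp (- x\<^sup>2 / 2) * u x))" for n
        by (intro integrable_mult_right integrable_of_real)
      ultimately show ?thesis
        using hermite_moments_zero[OF u u2 zero]
        by (simp only: Bochner_Integration.integral_sum integral_mult_right_zero integral_complex_of_real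
            of_real_0 mult_zero_right sum.neutral_const)
    qed
    ultimately show ?thesis
      by (simp add: LIMSEQ_const_iff)
  qed
  then have "AE x in lborel. ?g x = 0"
    by (rule fourier_transform_zero_imp_AE_zero[OF gi])
  then show ?thesis
    by simp
qed

section \<open>Passage from Borel to Lebesgue measurable functions\<close>

global_interpretation hermite: orthonormal_sequence lebesgue hermite_fun
proof
  show m: "hermite_fun n \<in> borel_measurable lebesgue" for n
    by (rule measurable_completion) simp
  show "integrable lebesgue (\<lambda>x. hermite_fun n x * hermite_fun m x)" for n m
    using integrable_hermite_fun_mult by (subst integrable_completion) auto
  show "(\<integral>x. hermite_fun n x * hermite_fun m x \<partial>lebesgue) = (if n = m then 1 else 0)" for n m
    using hermite_fun_orthonormal by (subst integral_completion) auto
qed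

lemma L2_eq: "L2 = Collect hermite.square_integrable"
  by (auto simp: L2_def hermite.square_integrable_def)

text \<open>A Lebesgue measurable function agrees almost everywhere with a Borel function, and
  changing it on a null set affects neither the hypotheses nor the conclusion.\<close>

lemma hermite_fun_complete_real_lebesgue:
  fixes u :: "real \<Rightarrow> real"
  assumes u [measurable]: "u \<in> borel_measurable lebesgue" and u2: "integrable lebesgue (\<lambda>x. (u x)\<^sup>2)"
    and zero: "\<And>n. (\<integral>x. hermite_fun n x * u x \<partial>lebesgue) = 0"
  shows "AE x in lebesgue. u x = 0"
proof -
  obtain v where v [measurable]: "v \<in> borel_measurable lborel" and "AE x in lborel. u x = v x"
    using completion_ex_borel_measurable_real[OF u] by blast
  then have uv: "AE x in lebesgue. u x = v x"
    by (intro AE_completion)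
  have vl [measurable]: "v \<in> borel_measurable lebesgue"
    by (rule measurable_completion) fact
  have "AE x in lborel. v x = 0"
  proof (rule hermite_fun_complete_real)
    have "integrable lebesgue (\<lambda>x. (v x)\<^sup>2)"
      by (rule integrable_cong_AE_imp[OF u2]) (use uv in \<open>auto\<close>)
    then show "integrable lborel (\<lambda>x. (v x)\<^sup>2)"
      by (subst (asm) integrable_completion) auto
    have "(\<integral>x. hermite_fun n x * v x \<partial>lebesgue) = (\<integral>x. hermite_fun n x * u x \<partial>lebesgue)" for n
      by (rule integral_cong_AE) (use uv in auto)
    then show "(\<integral>x. hermite_fun n x * v x \<partial>lborel) = 0" for n
      using zero by (subst integral_completion[symmetric]) auto
  qed (use v in simp)
  then have "AE x in lebesgue. v x = 0"
    by (rule AE_completion)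
  with uv show ?thesis
    by eventually_elim simp
qed

text \<open>Because the Hermite functions are real, the coefficients of the real and imaginary parts
  are the real and imaginary parts of the coefficients.\<close>

lemma hermite_fun_complete:
  assumes \<phi>: "hermite.square_integrable \<phi>" and zero: "\<And>n. hermite.fourier_coeff \<phi> n = 0"
  shows "AE x in lebesgue. \<phi> x = 0"
proof -
  have [measurable]: "\<phi> \<in> borel_measurable lebesgue" and i: "integrable lebesgue (\<lambda>x. (norm (\<phi> x))\<^sup>2)"
    using \<phi> by (auto simp: hermite.square_integrable_def)
  have "AE x in lebesgue. Re (\<phi> x) = 0"
  proof (rule hermite_fun_complete_real_lebesgue)
    show "integrable lebesgue (\<lambda>x. (Re (\<phi> x))\<^sup>2)"
      by (rule Bochner_Integration.integrable_bound[OF i]) (auto simp: cmod_power2)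
    show "(\<integral>x. hermite_fun n x * Re (\<phi> x) \<partial>lebesgue) = 0" for n
      using integral_Re[OF hermite.integrable_e_mult[OF \<phi>, of n]] zero[of n]
      by (simp add: hermite.fourier_coeff_def)
  qed simp
  moreover have "AE x in lebesgue. Im (\<phi> x) = 0"
  proof (rule hermite_fun_complete_real_lebesgue)
    show "integrable lebesgue (\<lambda>x. (Im (\<phi> x))\<^sup>2)"
      by (rule Bochner_Integration.integrable_bound[OF i]) (auto simp: cmod_power2)
    show "(\<integral>x. hermite_fun n x * Im (\<phi> x) \<partial>lebesgue) = 0" for n
      using integral_Im[OF hermite.integrable_e_mult[OF \<phi>, of n]] zero[of n]
      by (simp add: hermite.fourier_coeff_def)
  qed simp
  ultimately show ?thesis
    by eventually_elim (simp add: complex_eq_iff)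
qed

text \<open>Riesz-Fischer yields a function with the same coefficients whose norm is known; the
  difference has only zero coefficients, so completeness makes the two functions agree almost
  everywhere.\<close>

lemma hermite_parseval:
  assumes \<phi>: "hermite.square_integrable \<phi>"
  shows "(\<integral>x. (norm (\<phi> x))\<^sup>2 \<partial>lebesgue) = (\<Sum>n. (norm (hermite.fourier_coeff \<phi> n))\<^sup>2)"
proof -
  obtain f where f: "hermite.square_integrable f" "\<And>n. hermite.fourier_coeff f n = hermite.fourier_coeff \<phi> n"
    "(\<integral>x. (norm (f x))\<^sup>2 \<partial>lebesgue) = (\<Sum>n. (norm (hermite.fourier_coeff \<phi> n))\<^sup>2)"
    using hermite.riesz_fischer[OF hermite.bessel[OF \<phi>]] by blast
  have "AE x in lebesgue. \<phi> x - f x = 0"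
    using \<phi> f(1,2)
    by (intro hermite_fun_complete hermite.square_integrable_diff) (simp_all add: hermite.fourier_coeff_diff)
  then have "(\<integral>x. (norm (\<phi> x))\<^sup>2 \<partial>lebesgue) = (\<integral>x. (norm (f x))\<^sup>2 \<partial>lebesgue)"
    using \<phi> f(1) by (intro integral_cong_AE) (auto simp: hermite.square_integrable_def)
  then show ?thesis
    by (simp add: f(3))
qed

subsection \<open>Radial integrals in the complex plane\<close>

text \<open>A Borel measure on the plane that gives every box its area is Lebesgue measure, and
  boxes correspond to products of intervals.\<close>

lemma lborel_complex_eq_distr:
  "(lborel :: complex measure) =
    distr (lborel \<Otimes>\<^sub>M lborel) borel (\<lambda>p. complex_of_real (fst p) + \<i> * complex_of_real (snd p))"
  (is "_ = distr _ _ ?h")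
proof (rule lborel_eqI)
  fix l u :: complex
  assume le: "\<And>b. b \<in> Basis \<Longrightarrow> l \<bullet> b \<le> u \<bullet> b"
  have ri: "Re l \<le> Re u" "Im l \<le> Im u"
    using le[of 1] le[of \<i>] by (simp_all add: Basis_complex_def inner_complex_def)
  have "?h -` box l u \<inter> space (lborel \<Otimes>\<^sub>M lborel) = {Re l <..< Re u} \<times> {Im l <..< Im u}"
    by (auto simp: box_def Basis_complex_def inner_complex_def space_pair_measure)
  then have "emeasure (distr (lborel \<Otimes>\<^sub>M lborel) borel ?h) (box l u) =
      emeasure (lborel \<Otimes>\<^sub>M lborel) ({Re l <..< Re u} \<times> {Im l <..< Im u})"
    by (subst emeasure_distr) auto
  also have "\<dots> = ennreal ((Re u - Re l) * (Im u - Im l))"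
    using ri by (subst lborel.emeasure_pair_measure_Times) (auto simp: ennreal_mult)
  also have "\<dots> = ennreal (\<Prod>b\<in>Basis. (u - l) \<bullet> b)"
    by (simp add: Basis_complex_def inner_complex_def)
  finally show "emeasure (distr (lborel \<Otimes>\<^sub>M lborel) borel ?h) (box l u) = (\<Prod>b\<in>Basis. (u - l) \<bullet> b)" .
qed simp

text \<open>Both orders of integration are recorded because a shear moves one coordinate with the
  other held fixed, and the moving coordinate should be the inner variable.\<close>

lemma nn_integral_lborel_complex:
  fixes g :: "complex \<Rightarrow> ennreal"
  assumes [measurable]: "g \<in> borel_measurable borel"
  shows "(\<integral>\<^sup>+z. g z \<partial>lborel) = (\<integral>\<^sup>+y. \<integral>\<^sup>+x. g (complex_of_real x + \<i> * complex_of_real y) \<partial>lborel \<partial>lborel)" (is ?A)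
    and "(\<integral>\<^sup>+z. g z \<partial>lborel) = (\<integral>\<^sup>+x. \<integral>\<^sup>+y. g (complex_of_real x + \<i> * complex_of_real y) \<partial>lborel \<partial>lborel)" (is ?B)
proof -
  let ?f = "\<lambda>p. g (complex_of_real (fst p) + \<i> * complex_of_real (snd p))"
  have *: "(\<integral>\<^sup>+z. g z \<partial>lborel) = (\<integral>\<^sup>+p. ?f p \<partial>(lborel \<Otimes>\<^sub>M lborel))"
    by (subst lborel_complex_eq_distr) (simp add: nn_integral_distr)
  show ?A
    unfolding * using lborel_pair.nn_integral_snd[of ?f] by simp
  show ?B
    unfolding * using lborel.nn_integral_fst[of ?f lborel] by simp
qed

text \<open>On each line parallel to its direction, a shear is a translation.\<close>

lemma nn_integral_complex_shear:
  fixes g :: "complex \<Rightarrow> ennreal"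
  assumes [measurable]: "g \<in> borel_measurable borel"
  shows "(\<integral>\<^sup>+z. g (z + complex_of_real (a * Im z)) \<partial>lborel) = (\<integral>\<^sup>+z. g z \<partial>lborel)"
    and "(\<integral>\<^sup>+z. g (z + \<i> * complex_of_real (a * Re z)) \<partial>lborel) = (\<integral>\<^sup>+z. g z \<partial>lborel)"
proof -
  have "(\<integral>\<^sup>+x. g (complex_of_real x + \<i> * complex_of_real y + complex_of_real (a * y)) \<partial>lborel) =
      (\<integral>\<^sup>+x. g (complex_of_real x + \<i> * complex_of_real y) \<partial>lborel)" for y
    by (subst (2) nn_integral_real_affine[where c=1 and t="a * y"]) (simp_all add: add_ac)
  then show "(\<integral>\<^sup>+z. g (z + complex_of_real (a * Im z)) \<partial>lborel) = (\<integral>\<^sup>+z. g z \<partial>lborel)"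
    by (simp add: nn_integral_lborel_complex(1))
  have "(\<integral>\<^sup>+y. g (complex_of_real x + \<i> * complex_of_real y + \<i> * complex_of_real (a * x)) \<partial>lborel) =
      (\<integral>\<^sup>+y. g (complex_of_real x + \<i> * complex_of_real y) \<partial>lborel)" for x
    by (subst (2) nn_integral_real_affine[where c=1 and t="a * x"]) (simp_all add: algebra_simps)
  then show "(\<integral>\<^sup>+z. g (z + \<i> * complex_of_real (a * Re z)) \<partial>lborel) = (\<integral>\<^sup>+z. g z \<partial>lborel)"
    by (simp add: nn_integral_lborel_complex(2))
qed

text \<open>A rotation by an angle other than \<open>pi\<close> is a product of three shears.\<close>

lemma nn_integral_complex_rotate:
  fixes g :: "complex \<Rightarrow> ennreal"
  assumes [measurable]: "g \<in> borel_measurable borel" and w: "norm w = 1"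
  shows "(\<integral>\<^sup>+z. g (w * z) \<partial>lborel) = (\<integral>\<^sup>+z. g z \<partial>lborel)"
proof -
  have rot: "(\<integral>\<^sup>+z. g (w * z) \<partial>lborel) = (\<integral>\<^sup>+z. g z \<partial>lborel)"
    if [measurable]: "g \<in> borel_measurable borel" and w: "norm w = 1" "w \<noteq> -1" for g :: "complex \<Rightarrow> ennreal" and w
  proof -
    define c where "c = Re w"
    define s where "s = Im w"
    \<comment> \<open>The tangent of half the angle of \<open>w\<close>. The outer shears use
      \<open>- t\<close> and the middle one the sine \<open>s\<close>; the denominator is nonzero
      precisely because \<open>w\<close> is not -1.\<close>
    define t where "t = s / (1 + c)"
    have cs: "c\<^sup>2 + s\<^sup>2 = 1"
      using w(1) by (simp add: c_def s_def cmod_def)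
    have "c \<noteq> -1"
      using cs w(2) by (auto simp: c_def s_def complex_eq_iff)
    then have c: "1 + c \<noteq> 0"
      by simp
    then have t: "t * (1 + c) = s"
      by (simp add: t_def)
    have "t * s * (1 + c) = (1 - c) * (1 + c)"
      using t cs by (simp add: power2_eq_square algebra_simps)
    then have ts: "t * s = 1 - c"
      using c by simp
    define T where "T = (\<lambda>z. z + complex_of_real (- t * Im z))"
    define S where "S = (\<lambda>z. z + \<i> * complex_of_real (s * Re z))"
    have [measurable]: "T \<in> borel_measurable borel" "S \<in> borel_measurable borel"
      unfolding T_def S_def by measurable
    have "T (S (T z)) = w * z" for z
    proof -
      have "Re (T (S (T z))) = Re z * (1 - t * s) - Im z * (t + t * (1 - t * s))"
        by (simp add: T_def S_def algebra_simps)
      also have "\<dots> = Re (w * z)"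
        unfolding ts using t by (simp add: c_def s_def algebra_simps)
      finally have "Re (T (S (T z))) = Re (w * z)" .
      moreover have "Im (T (S (T z))) = s * Re z + Im z * (1 - t * s)"
        by (simp add: T_def S_def algebra_simps)
      then have "Im (T (S (T z))) = Im (w * z)"
        unfolding ts by (simp add: c_def s_def algebra_simps)
      ultimately show ?thesis
        by (simp add: complex_eq_iff)
    qed
    then have "(\<integral>\<^sup>+z. g (w * z) \<partial>lborel) = (\<integral>\<^sup>+z. g (T (S (T z))) \<partial>lborel)"
      by simp
    also have "\<dots> = (\<integral>\<^sup>+z. g (T (S z)) \<partial>lborel)"
      using nn_integral_complex_shear(1)[of "\<lambda>z. g (T (S z))" "- t"] by (simp add: T_def)
    also have "\<dots> = (\<integral>\<^sup>+z. g (T z) \<partial>lborel)"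
      using nn_integral_complex_shear(2)[of "\<lambda>z. g (T z)" s] by (simp add: S_def)
    also have "\<dots> = (\<integral>\<^sup>+z. g z \<partial>lborel)"
      using nn_integral_complex_shear(1)[of g "- t"] by (simp add: T_def)
    finally show ?thesis .
  qed
  show ?thesis
  proof (cases "w = -1")
    case True
    \<comment> \<open>The half turn is two quarter turns, to which the shear argument
      applies.\<close>
    have "(\<integral>\<^sup>+z. g (\<i> * (\<i> * z)) \<partial>lborel) = (\<integral>\<^sup>+z. g (\<i> * z) \<partial>lborel)"
      using rot[of "\<lambda>z. g (\<i> * z)" \<i>] by (simp add: complex_eq_iff)
    also have "\<dots> = (\<integral>\<^sup>+z. g z \<partial>lborel)"
      using rot[of g \<i>] by (simp add: complex_eq_iff)
    finally show ?thesis
      by (simp add: True flip: mult.assoc)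
  qed (use rot w in simp)
qed

text \<open>The preimage of \<open>{..a}\<close> for \<open>a \<ge> 0\<close> is a disc of radius
  \<open>a powr (q / 2)\<close>, with area \<open>pi * a powr q\<close>; the density is the
  derivative of this area in \<open>a\<close>. The half-lines are stable under intersection and
  generate the Borel sets, so they determine the measure.\<close>

lemma distr_norm_powr:
  fixes q :: real
  assumes q: "q > 0"
  shows "distr (lborel :: complex measure) borel (\<lambda>z. norm z powr (2 / q)) =
    density lborel (\<lambda>t. ennreal (pi * q * t powr (q - 1)) * indicator {0..} t)"
    (is "?M = ?N")
proof (rule measure_eqI_generator_eq)
  have eq: "emeasure ?M {..a} = ennreal (if a \<ge> 0 then pi * a powr q else 0)"
    "emeasure ?N {..a} = ennreal (if a \<ge> 0 then pi * a powr q else 0)" for a :: real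
  proof -
    have "{z::complex. norm z powr (2 / q) \<le> a} = (if a \<ge> 0 then cball 0 (a powr (q / 2)) else {})"
    proof (cases "a \<ge> 0")
      case True
      have "norm z powr (2 / q) \<le> a \<longleftrightarrow> norm z \<le> a powr (q / 2)" for z :: complex
      proof -
        have "norm z \<le> a powr (q / 2) \<longleftrightarrow> norm z powr (2 / q) \<le> (a powr (q / 2)) powr (2 / q)"
          using q powr_mono2[of "2 / q" "norm z" "a powr (q / 2)"] powr_less_mono2[of "2 / q" "a powr (q / 2)" "norm z"]
          by force
        also have "(a powr (q / 2)) powr (2 / q) = a"
          using q True by (simp add: powr_powr)
        finally show ?thesis by simp
      qed
      with True show ?thesis
        by (simp add: set_eq_iff)
    next
      case False
      then have "\<not> norm z powr (2 / q) \<le> a" for z :: complex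
        using powr_ge_zero[of "norm z" "2 / q"] by linarith
      with False show ?thesis by auto
    qed
    moreover have "emeasure ?M {..a} = emeasure lborel {z::complex. norm z powr (2 / q) \<le> a}"
      by (subst emeasure_distr) (simp_all add: vimage_def)
    moreover have "emeasure lborel (cball (0::complex) (a powr (q / 2))) = ennreal (pi * a powr q)"
      using emeasure_cball[of "a powr (q / 2)" "0::complex"]
      by (simp add: unit_ball_vol_2 power2_eq_square flip: powr_add)
    ultimately show "emeasure ?M {..a} = ennreal (if a \<ge> 0 then pi * a powr q else 0)"
      by simp
    have "emeasure ?N {..a} = (\<integral>\<^sup>+t. ennreal (pi * q * t powr (q - 1)) * indicator {0..a} t \<partial>lborel)"
      by (subst emeasure_density) (auto intro!: nn_integral_cong split: split_indicator)
    also have "\<dots> = ennreal (if a \<ge> 0 then pi * a powr q else 0)"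
    proof (cases "a \<ge> 0")
      case True
      have "((\<lambda>t. pi * q * t powr (q - 1)) has_integral pi * q * (a powr (q - 1 + 1) / (q - 1 + 1))) {0..a}"
        using q True by (intro has_integral_mult_right has_integral_powr_from_0) auto
      then show ?thesis
        using q True by (subst nn_integral_has_integral_lebesgue') auto
    qed simp
    finally show "emeasure ?N {..a} = ennreal (if a \<ge> 0 then pi * a powr q else 0)" .
  qed
  let ?E = "range (\<lambda>a::real. {..a})"
  show "Int_stable ?E"
    by (auto simp: Int_stable_def)
  show "?E \<subseteq> Pow UNIV" "sets ?M = sigma_sets UNIV ?E" "sets ?N = sigma_sets UNIV ?E"
    by (simp_all add: borel_eq_atMost)
  show "range (\<lambda>n::nat. {..real n}) \<subseteq> ?E" "(\<Union>n::nat. {..real n}) = UNIV"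
    by (auto intro: real_arch_simple)
  show "emeasure ?M {..real n} \<noteq> \<infinity>" for n :: nat
    by (simp add: eq)
  show "emeasure ?M X = emeasure ?N X" if "X \<in> ?E" for X
    using that by (auto simp: eq)
qed

section \<open>Gamma integrals: moments of the weight and growth of its normalization\<close>

lemma Gamma_Suc_conv_nn_integral:
  assumes "s \<ge> (0::real)"
  shows "ennreal (Gamma (s + 1)) = (\<integral>\<^sup>+t. ennreal (t powr s * exp (- t)) * indicator {0..} t \<partial>lborel)"
  using Gamma_conv_nn_integral_real[of "s + 1"] assms
  by (simp add: exp_minus divide_inverse ennreal_mult'' ennreal_indicator mult_ac)

text \<open>Under \<open>t = norm z powr (2 / q)\<close> the power becomes
  \<open>t powr (q * n)\<close>, and the factor \<open>norm z powr (2 / q - 2)\<close> becomes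
  \<open>t powr (1 - q)\<close>, which cancels the power of \<open>t\<close> in the push-forward of
  area. What remains is Euler's integral.\<close>

lemma mittag_leffler_moment:
  assumes q: "q > 0"
  shows "(\<integral>\<^sup>+z. ennreal (norm z ^ (2 * n) * mittag_leffler_density q z) \<partial>lborel) =
    ennreal (pi * q * Gamma (q * real n + 1))"
proof -
  define G where "G = (\<lambda>t::real. t powr (q * real n + (1 - q)) * exp (- t))"
  \<comment> \<open>At the origin both sides are 0, since \<open>powr\<close> with base 0 is 0 for
    every exponent.\<close>
  have G: "norm z ^ (2 * n) * mittag_leffler_density q z = G (norm z powr (2 / q))" for z
  proof (cases "z = 0")
    case False
    have "(norm z powr (2 / q)) powr (q * real n + (1 - q)) = norm z powr (real (2 * n) + (2 / q - 2))"
      using q by (simp add: powr_powr field_simps)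
    also have "\<dots> = norm z ^ (2 * n) * norm z powr (2 / q - 2)"
      using False by (subst powr_add) (simp add: powr_realpow del: of_nat_mult)
    finally show ?thesis
      by (simp add: G_def mittag_leffler_density_def)
  qed (simp add: G_def mittag_leffler_density_def)
  have "(\<integral>\<^sup>+z. ennreal (norm z ^ (2 * n) * mittag_leffler_density q z) \<partial>lborel) =
      (\<integral>\<^sup>+t. ennreal (G t) \<partial>distr (lborel :: complex measure) borel (\<lambda>z. norm z powr (2 / q)))"
    unfolding G by (subst nn_integral_distr) (auto simp: G_def)
  also have "\<dots> = (\<integral>\<^sup>+t. ennreal (pi * q * t powr (q - 1)) * indicator {0..} t * ennreal (G t) \<partial>lborel)"
    unfolding distr_norm_powr[OF q] by (subst nn_integral_density) (auto simp: G_def)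
  also have "\<dots> = (\<integral>\<^sup>+t. ennreal (pi * q) * (ennreal (t powr (q * real n) * exp (- t)) * indicator {0..} t) \<partial>lborel)"
  proof (rule nn_integral_cong_AE)
    have "AE t::real in lborel. t \<noteq> 0"
      by (rule AE_lborel_singleton)
    then show "AE t in lborel. ennreal (pi * q * t powr (q - 1)) * indicator {0..} t * ennreal (G t) =
        ennreal (pi * q) * (ennreal (t powr (q * real n) * exp (- t)) * indicator {0..} t)"
    proof eventually_elim
      case (elim t)
      show ?case
      proof (cases "t > 0")
        case True
        have "pi * q * t powr (q - 1) * G t = pi * q * (t powr (q * real n) * exp (- t))"
          using True by (simp add: G_def mult.assoc flip: powr_add)
        then show ?thesis
          using True q by (simp add: G_def flip: ennreal_mult)
      qed (use elim in \<open>simp add: indicator_def\<close>)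
    qed
  qed
  also have "\<dots> = ennreal (pi * q) * ennreal (Gamma (q * real n + 1))"
    using q by (subst nn_integral_cmult) (auto simp: Gamma_Suc_conv_nn_integral)
  also have "\<dots> = ennreal (pi * q * Gamma (q * real n + 1))"
    using q by (simp add: ennreal_mult')
  finally show ?thesis .
qed

text \<open>Only the part of Euler's integral over \<open>{T..T+1}\<close> is kept, where the
  integrand is at least \<open>T powr s * exp (- T - 1)\<close>. As \<open>T\<close> is free, Gamma
  beats every geometric sequence in \<open>s\<close>.\<close>

lemma Gamma_ge_powr_exp:
  fixes s T :: real
  assumes "s \<ge> 0" "T > 0"
  shows "T powr s * exp (- T - 1) \<le> Gamma (s + 1)"
proof -
  have "ennreal (T powr s * exp (- T - 1)) = (\<integral>\<^sup>+t. ennreal (T powr s * exp (- T - 1)) * indicator {T..T+1} t \<partial>lborel)"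
    by (subst nn_integral_cmult_indicator) auto
  also have "\<dots> \<le> (\<integral>\<^sup>+t. ennreal (t powr s * exp (- t)) * indicator {0..} t \<partial>lborel)"
    using assms
    by (intro nn_integral_mono) (auto intro!: ennreal_leI mult_mono powr_mono2 split: split_indicator)
  also have "\<dots> = ennreal (Gamma (s + 1))"
    by (simp add: Gamma_Suc_conv_nn_integral assms)
  finally show ?thesis
    using assms by (subst (asm) ennreal_le_iff) (auto intro!: Gamma_real_nonneg)
qed

lemma summable_power_over_sqrt_Gamma:
  fixes q R :: real
  assumes q: "q > 0" and R: "R \<ge> 0"
  shows "summable (\<lambda>n. R ^ n / sqrt (Gamma (q * real n + 1)))"
proof (rule summable_comparison_test)
  \<comment> \<open>Chosen so that the square root of \<open>T powr (q * n)\<close> is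
    \<open>(2 * (R + 1)) ^ n\<close>, leaving the ratio \<open>R / (2 * (R + 1))\<close>, at most
    1/2. Using \<open>R + 1\<close> keeps the base positive when \<open>R = 0\<close>;
    \<open>A\<close> below is the square root of \<open>exp (- T - 1)\<close>.\<close>
  define T where "T = (2 * (R + 1)) powr (2 / q)"
  have T: "T > 0"
    using R by (simp add: T_def)
  define A where "A = exp (- (T + 1) / 2)"
  show "summable (\<lambda>n. (1/2) ^ n / A)"
    by (intro summable_divide summable_geometric) simp
  have "norm (R ^ n / sqrt (Gamma (q * real n + 1))) \<le> (1/2) ^ n / A" for n
  proof -
    have G0: "Gamma (q * real n + 1) > 0"
      using q by (intro Gamma_real_pos) (simp add: add_nonneg_pos)
    have "T powr (q * real n) = (2 * (R + 1)) powr (2 * real n)"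
      unfolding T_def powr_powr using q by simp
    also have "\<dots> = ((2 * (R + 1)) ^ n)\<^sup>2"
      using R powr_realpow[of "2 * (R + 1)" "2 * n"] by (simp add: power_even_eq)
    finally have "((2 * (R + 1)) ^ n)\<^sup>2 * exp (- T - 1) \<le> Gamma (q * real n + 1)"
      using Gamma_ge_powr_exp[of "q * real n" T] T q by simp
    moreover have "exp (- T - 1) = A\<^sup>2"
      by (simp add: A_def flip: exp_double)
    ultimately have "((2 * (R + 1)) ^ n * A)\<^sup>2 \<le> Gamma (q * real n + 1)"
      by (simp add: power_mult_distrib)
    then have le: "(2 * (R + 1)) ^ n * A \<le> sqrt (Gamma (q * real n + 1))"
      by (rule real_le_rsqrt)
    have A: "A > 0"
      by (simp add: A_def)
    have "R ^ n / sqrt (Gamma (q * real n + 1)) \<le> R ^ n / ((2 * (R + 1)) ^ n * A)"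
      using R A le G0 by (intro divide_left_mono mult_pos_pos) auto
    also have "\<dots> = (R / (2 * (R + 1))) ^ n / A"
      by (simp add: power_divide)
    also have "\<dots> \<le> (1/2) ^ n / A"
      using R A by (intro divide_right_mono power_mono) (auto simp: field_simps)
    finally show ?thesis
      using R G0 by simp
  qed
  then show "\<exists>N. \<forall>n\<ge>N. norm (R ^ n / sqrt (Gamma (q * real n + 1))) \<le> (1/2) ^ n / A"
    by blast
qed

subsection \<open>The Fock norm of a power series\<close>

abbreviation circle_measure :: "real measure" where
  "circle_measure \<equiv> restrict_space lborel {0..2 * pi}"

interpretation circle: finite_measure circle_measure
  by standard (simp add: emeasure_restrict_space)

lemma measure_circle: "measure circle_measure {0..2 * pi} = 2 * pi"
  by (simp add: measure_restrict_space)

lemma continuous_borel_circle: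
  fixes f :: "real \<Rightarrow> 'a::topological_space"
  assumes "continuous_on UNIV f"
  shows "f \<in> borel_measurable circle_measure"
  using borel_measurable_continuous_onI[OF assms] by (intro measurable_restrict_space1) simp

lemma integrable_circle:
  fixes f :: "real \<Rightarrow> 'a::{banach, second_countable_topology}"
  assumes "f \<in> borel_measurable circle_measure" "\<And>t. norm (f t) \<le> B"
  shows "integrable circle_measure f"
  using assms by (intro circle.integrable_const_bound[of _ B]) auto

lemma integral_cis_circle:
  "(\<integral>t. cis (of_int k * t) \<partial>circle_measure) = (if k = 0 then 2 * pi else 0)"
proof (cases "k = 0")
  case True
  then show ?thesis by (simp add: measure_circle scaleR_conv_of_real)
next
  case False
  let ?f = "\<lambda>t. cis (of_int k * t)"
  have si: "set_integrable lborel {0..2 * pi} ?f"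
    by (intro borel_integrable_atLeastAtMost') (intro continuous_intros)
  have "(?f has_integral (cis (of_int k * (2 * pi)) / (\<i> * of_int k) - cis (of_int k * 0) / (\<i> * of_int k))) {0..2 * pi}"
  proof (rule fundamental_theorem_of_calculus)
    show "((\<lambda>t. cis (of_int k * t) / (\<i> * of_int k)) has_vector_derivative cis (of_int k * t)) (at t within {0..2 * pi})" for t
      unfolding cis_conv_exp
      by (rule has_vector_derivative_eq_rhs, rule has_vector_derivative_divide,
          rule field_vector_diff_chain_within[unfolded o_def, where f="\<lambda>t. \<i> * complex_of_real (of_int k * t)" and g=exp and f'="\<i> * of_int k"])
        (use False in \<open>auto intro!: derivative_eq_intros DERIV_exp simp: has_vector_derivative_def scaleR_conv_of_real fun_eq_iff mult_ac\<close>)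
  qed simp
  moreover have "cis (of_int k * (2 * pi)) = 1"
    by (metis cis_multiple_2pi Ints_of_int mult.commute)
  ultimately have "(?f has_integral 0) {0..2 * pi}"
    by simp
  then have "(LINT t:{0..2 * pi}|lborel. ?f t) = 0"
    using set_borel_integral_eq_integral(2)[OF si] by (simp add: integral_unique)
  then show ?thesis
    using False by (simp add: integral_restrict_space set_lebesgue_integral_def)
qed

text \<open>Absolute summability makes \<open>F\<close> bounded and permits termwise integration
  twice: once to recover \<open>b m\<close> as a Fourier coefficient of \<open>F\<close>, and once
  after expanding only the conjugate factor in \<open>F t * cnj (F t)\<close>.\<close>

lemma parseval_circle:
  fixes b :: "nat \<Rightarrow> complex"
  assumes b: "summable (\<lambda>n. norm (b n))"
  defines "F \<equiv> \<lambda>t. \<Sum>n. b n * cis (real n * t)"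
  shows "(\<integral>\<^sup>+t. ennreal ((norm (F t))\<^sup>2) \<partial>circle_measure) = (\<Sum>n. ennreal (2 * pi * (norm (b n))\<^sup>2))"
proof -
  define B where "B = (\<Sum>n. norm (b n))"
  have bs: "summable (\<lambda>n. norm (b n * cis (real n * t)))" for t
    using b by (simp add: norm_mult)
  have FB: "norm (F t) \<le> B" for t
    unfolding F_def B_def using summable_norm[OF bs[of t]] by (simp add: norm_mult)
  have cm [measurable]: "(\<lambda>t. cis (c * t)) \<in> borel_measurable circle_measure" for c
    by (intro continuous_borel_circle continuous_intros)
  have Fm [measurable]: "F \<in> borel_measurable circle_measure"
    unfolding F_def by measurable
  have coeff: "(\<integral>t. F t * cis (- real m * t) \<partial>circle_measure) = 2 * pi * b m" for m
  proof -
    let ?f = "\<lambda>n t. b n * cis (of_int (int n - int m) * t)"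
    have "(\<lambda>n. \<integral>t. ?f n t \<partial>circle_measure) sums (\<integral>t. (\<Sum>n. ?f n t) \<partial>circle_measure)"
    proof (rule sums_integral)
      show "integrable circle_measure (?f n)" for n
        by (rule integrable_circle[of _ "norm (b n)"]) (simp_all add: norm_mult)
      show "AE t in circle_measure. summable (\<lambda>n. norm (?f n t))"
        using b by (simp add: norm_mult)
      show "summable (\<lambda>n. \<integral>t. norm (?f n t) \<partial>circle_measure)"
        using b by (simp add: norm_mult measure_circle summable_mult)
    qed
    also have "(\<lambda>n. \<integral>t. ?f n t \<partial>circle_measure) = (\<lambda>n. if n = m then 2 * pi * b m else 0)"
      unfolding integral_mult_right_zero integral_cis_circle by auto
    also have "(\<lambda>t. \<Sum>n. ?f n t) = (\<lambda>t. F t * cis (- real m * t))"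
    proof
      fix t
      have eq: "?f n t = b n * cis (real n * t) * cis (- real m * t)" for n
        by (simp add: mult.assoc cis_mult algebra_simps)
      show "(\<Sum>n. ?f n t) = F t * cis (- real m * t)"
        unfolding F_def eq by (rule suminf_mult2[OF summable_norm_cancel[OF bs], symmetric])
    qed
    finally show ?thesis
      using sums_single[of m "\<lambda>_. 2 * pi * b m"] sums_unique2 by fastforce
  qed
  have "(\<lambda>m. \<integral>t. cnj (b m) * (F t * cis (- real m * t)) \<partial>circle_measure) sums
      (\<integral>t. (\<Sum>m. cnj (b m) * (F t * cis (- real m * t))) \<partial>circle_measure)"
  proof (rule sums_integral)
    have le: "norm (cnj (b m) * (F t * cis (- real m * t))) \<le> norm (b m) * B" for m t
      using FB[of t] by (simp add: norm_mult mult_left_mono)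
    show i: "integrable circle_measure (\<lambda>t. cnj (b m) * (F t * cis (- real m * t)))" for m
      by (rule integrable_circle[OF _ le]) measurable
    show "AE t in circle_measure. summable (\<lambda>m. norm (cnj (b m) * (F t * cis (- real m * t))))"
      using b by (simp add: norm_mult summable_mult2)
    show "summable (\<lambda>m. \<integral>t. norm (cnj (b m) * (F t * cis (- real m * t))) \<partial>circle_measure)"
    proof (rule summable_comparison_test)
      show "summable (\<lambda>m. norm (b m) * B * (2 * pi))"
        by (intro summable_mult2 b)
      have "norm (\<integral>t. norm (cnj (b m) * (F t * cis (- real m * t))) \<partial>circle_measure) \<le> norm (b m) * B * (2 * pi)" for m
      proof -
        have "norm (\<integral>t. norm (cnj (b m) * (F t * cis (- real m * t))) \<partial>circle_measure) =
            (\<integral>t. norm (cnj (b m) * (F t * cis (- real m * t))) \<partial>circle_measure)"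
          by simp
        also have "\<dots> \<le> (\<integral>t. norm (b m) * B \<partial>circle_measure)"
          by (intro integral_mono integrable_norm i le) auto
        also have "\<dots> = norm (b m) * B * (2 * pi)"
          by (simp add: measure_circle)
        finally show ?thesis .
      qed
      then show "\<exists>N. \<forall>m\<ge>N. norm (\<integral>t. norm (cnj (b m) * (F t * cis (- real m * t))) \<partial>circle_measure) \<le> norm (b m) * B * (2 * pi)"
        by blast
    qed
  qed
  also have "(\<lambda>m. \<integral>t. cnj (b m) * (F t * cis (- real m * t)) \<partial>circle_measure) =
      (\<lambda>m. complex_of_real (2 * pi * (norm (b m))\<^sup>2))"
    unfolding integral_mult_right_zero coeff by (simp add: mult_ac fun_eq_iff flip: complex_norm_square)
  also have "(\<lambda>t. \<Sum>m. cnj (b m) * (F t * cis (- real m * t))) = (\<lambda>t. complex_of_real ((norm (F t))\<^sup>2))"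
  proof
    fix t
    have "(\<lambda>m. cnj (b m * cis (real m * t))) sums cnj (F t)"
      unfolding F_def using summable_sums[OF summable_norm_cancel[OF bs[of t]]] by (simp only: sums_cnj)
    from sums_mult[OF this, of "F t"]
    have "(\<lambda>m. cnj (b m) * (F t * cis (- real m * t))) sums (F t * cnj (F t))"
      by (simp add: mult_ac cis_cnj)
    then show "(\<Sum>m. cnj (b m) * (F t * cis (- real m * t))) = complex_of_real ((norm (F t))\<^sup>2)"
      by (simp only: sums_unique[symmetric] complex_norm_square)
  qed
  finally have sums: "(\<lambda>m. 2 * pi * (norm (b m))\<^sup>2) sums (\<integral>t. (norm (F t))\<^sup>2 \<partial>circle_measure)"
    by (simp only: integral_complex_of_real sums_of_real_iff)
  have "integrable circle_measure (\<lambda>t. (norm (F t))\<^sup>2)"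
    using FB by (intro integrable_circle[of _ "B\<^sup>2"]) (auto intro: power_mono)
  then have "(\<integral>\<^sup>+t. ennreal ((norm (F t))\<^sup>2) \<partial>circle_measure) = ennreal (\<integral>t. (norm (F t))\<^sup>2 \<partial>circle_measure)"
    by (intro nn_integral_eq_integral) auto
  also have "\<dots> = (\<Sum>m. ennreal (2 * pi * (norm (b m))\<^sup>2))"
    using sums by (simp add: sums_iff suminf_ennreal2)
  finally show ?thesis .
qed

text \<open>Convergence at a point of larger modulus, here \<open>norm z + 1\<close>, implies
  absolute convergence at \<open>z\<close>.\<close>

lemma summable_norm_entire_power_series:
  fixes c :: "nat \<Rightarrow> complex"
  assumes "\<And>z. summable (\<lambda>n. c n * z ^ n)"
  shows "summable (\<lambda>n. norm (c n * z ^ n))"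
  by (rule powser_insidea[OF assms[of "of_real (norm z + 1)"]]) (simp add: norm_of_real)

text \<open>The weight is radial, so the integral is unchanged if \<open>f\<close> is replaced by its rotations;
  averaging over all of them reduces the claim to Parseval's identity on circles.\<close>

theorem nn_integral_mittag_leffler_power_series:
  fixes f :: "complex \<Rightarrow> complex"
  assumes q: "q > 0" and f: "\<And>z. (\<lambda>n. c n * z ^ n) sums f z"
  shows "(\<integral>\<^sup>+z. ennreal ((norm (f z))\<^sup>2 * mittag_leffler_density q z) \<partial>lborel) =
    ennreal (q * pi) * (\<Sum>n. ennreal ((norm (c n))\<^sup>2 * Gamma (q * real n + 1)))"
proof -
  have summ: "summable (\<lambda>n. c n * z ^ n)" for z
    using f sums_summable by blast
  have feq: "f z = (\<Sum>n. c n * z ^ n)" for z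
    using f sums_unique by blast
  have fm [measurable]: "f \<in> borel_measurable borel"
    unfolding feq[abs_def] by measurable
  have wm [measurable]: "mittag_leffler_density q \<in> borel_measurable borel"
    unfolding mittag_leffler_density_def[abs_def] by measurable
  have wn: "mittag_leffler_density q z \<ge> 0" for z
    by (simp add: mittag_leffler_density_def)
  have wr: "mittag_leffler_density q (cis t * z) = mittag_leffler_density q z" for t z
    by (simp add: mittag_leffler_density_def norm_mult)
  let ?W = "\<lambda>z. ennreal ((norm (f z))\<^sup>2 * mittag_leffler_density q z)"
  interpret C: pair_sigma_finite "lborel :: complex measure" circle_measure
    by standard
  have cism [measurable]: "cis \<in> borel_measurable circle_measure"
    by (intro continuous_borel_circle continuous_intros)
  have "ennreal (2 * pi) * (\<integral>\<^sup>+z. ?W z \<partial>lborel) = (\<integral>\<^sup>+t. (\<integral>\<^sup>+z. ?W z \<partial>lborel) \<partial>circle_measure)"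
    by (simp add: emeasure_restrict_space mult.commute)
  also have "\<dots> = (\<integral>\<^sup>+t. (\<integral>\<^sup>+z. ?W (cis t * z) \<partial>lborel) \<partial>circle_measure)"
    by (subst nn_integral_complex_rotate[of ?W]) auto
  \<comment> \<open>Tonelli: the integrand is nonnegative, so no finiteness is presupposed and both
    sides of the final formula may be infinite.\<close>
  also have "\<dots> = (\<integral>\<^sup>+z. (\<integral>\<^sup>+t. ?W (cis t * z) \<partial>circle_measure) \<partial>lborel)"
    by (rule C.Fubini') measurable
  also have "\<dots> = (\<integral>\<^sup>+z. (\<Sum>n. ennreal (2 * pi * (norm (c n))\<^sup>2) * ennreal (norm z ^ (2 * n) * mittag_leffler_density q z)) \<partial>lborel)"
  proof (rule nn_integral_cong)
    fix z :: complex
    have fz: "f (cis t * z) = (\<Sum>n. c n * z ^ n * cis (real n * t))" for t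
      unfolding feq by (simp add: power_mult_distrib mult_ac Complex.DeMoivre)
    have "(\<integral>\<^sup>+t. ?W (cis t * z) \<partial>circle_measure) =
        (\<integral>\<^sup>+t. ennreal (mittag_leffler_density q z) * ennreal ((norm (f (cis t * z)))\<^sup>2) \<partial>circle_measure)"
      unfolding wr using wn by (simp add: mult.commute flip: ennreal_mult)
    also have "\<dots> = ennreal (mittag_leffler_density q z) * (\<integral>\<^sup>+t. ennreal ((norm (f (cis t * z)))\<^sup>2) \<partial>circle_measure)"
      by (rule nn_integral_cmult) measurable
    also have "(\<integral>\<^sup>+t. ennreal ((norm (f (cis t * z)))\<^sup>2) \<partial>circle_measure) = (\<Sum>n. ennreal (2 * pi * (norm (c n * z ^ n))\<^sup>2))"
      unfolding fz by (rule parseval_circle[OF summable_norm_entire_power_series[OF summ]])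
    also have "ennreal (mittag_leffler_density q z) * \<dots> =
        (\<Sum>n. ennreal (mittag_leffler_density q z) * ennreal (2 * pi * (norm (c n * z ^ n))\<^sup>2))"
      by (rule ennreal_suminf_cmult[symmetric])
    also have "\<dots> = (\<Sum>n. ennreal (2 * pi * (norm (c n))\<^sup>2) * ennreal (norm z ^ (2 * n) * mittag_leffler_density q z))"
      using wn by (intro suminf_cong)
        (simp add: norm_mult norm_power power_mult_distrib mult_ac flip: ennreal_mult power_mult)
    finally show "(\<integral>\<^sup>+t. ?W (cis t * z) \<partial>circle_measure) =
        (\<Sum>n. ennreal (2 * pi * (norm (c n))\<^sup>2) * ennreal (norm z ^ (2 * n) * mittag_leffler_density q z))" .
  qed
  also have "\<dots> = (\<Sum>n. ennreal (2 * pi * (norm (c n))\<^sup>2) * ennreal (pi * q * Gamma (q * real n + 1)))"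
    by (subst nn_integral_suminf) (auto simp: nn_integral_cmult mittag_leffler_moment[OF q])
  also have "\<dots> = (\<Sum>n. ennreal (2 * pi) * (ennreal (q * pi) * ennreal ((norm (c n))\<^sup>2 * Gamma (q * real n + 1))))"
  proof -
    have "Gamma (q * real n + 1) \<ge> 0" for n
      using q by (intro Gamma_real_nonneg) (simp add: add_nonneg_pos)
    then show ?thesis
      using q by (intro suminf_cong) (simp add: mult_ac flip: ennreal_mult)
  qed
  also have "\<dots> = ennreal (2 * pi) * (ennreal (q * pi) * (\<Sum>n. ennreal ((norm (c n))\<^sup>2 * Gamma (q * real n + 1))))"
    by simp
  finally show ?thesis
    by (simp add: ennreal_mult_cancel_left)
qed

subsection \<open>The Mittag-Leffler Bargmann transform\<close>

definition MLB_coeff :: "real \<Rightarrow> (nat \<Rightarrow> complex) \<Rightarrow> nat \<Rightarrow> complex" where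
  "MLB_coeff q a n = a n / of_real (sqrt (Gamma (q * real n + 1)))"

lemma Gamma_mult_nat_pos: "q > 0 \<Longrightarrow> Gamma (q * real n + 1) > (0::real)"
  by (intro Gamma_real_pos) (simp add: add_nonneg_pos)

lemma norm_MLB_kernel_term:
  assumes "q > 0"
  shows "norm (MLB_kernel_term q z x n) = norm z ^ n / sqrt (Gamma (q * real n + 1)) * \<bar>hermite_fun n x\<bar>"
  using Gamma_mult_nat_pos[OF assms, of n]
  by (simp add: MLB_kernel_term_def norm_mult norm_divide norm_power)

text \<open>The geometric growth of the Hermite functions merges with the power of \<open>z\<close>:
  the series is dominated by the Gamma series at radius
  \<open>norm z * (1 + 2 * \<bar>x\<bar>)\<close>.\<close>

lemma summable_norm_MLB_kernel_term:
  assumes q: "q > 0"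
  shows "summable (\<lambda>n. norm (MLB_kernel_term q z x n))"
proof -
  obtain C where C: "C \<ge> 0" "\<And>n. \<bar>hermite_fun n x\<bar> \<le> C * (1 + 2 * \<bar>x\<bar>) ^ n"
    using hermite_fun_bound by blast
  have "summable (\<lambda>n. C * ((norm z * (1 + 2 * \<bar>x\<bar>)) ^ n / sqrt (Gamma (q * real n + 1))))"
    by (intro summable_mult summable_power_over_sqrt_Gamma q) simp
  then show ?thesis
  proof (rule summable_comparison_test_ev[rotated], intro always_eventually allI)
    fix n
    have "norm z ^ n / sqrt (Gamma (q * real n + 1)) * \<bar>hermite_fun n x\<bar> \<le>
        norm z ^ n / sqrt (Gamma (q * real n + 1)) * (C * (1 + 2 * \<bar>x\<bar>) ^ n)"
      using C Gamma_mult_nat_pos[OF q, of n] by (intro mult_left_mono) auto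
    then show "norm (norm (MLB_kernel_term q z x n)) \<le>
        C * ((norm z * (1 + 2 * \<bar>x\<bar>)) ^ n / sqrt (Gamma (q * real n + 1)))"
      using Gamma_mult_nat_pos[OF q, of n]
      by (simp add: norm_MLB_kernel_term[OF q] power_mult_distrib mult_ac)
  qed
qed

text \<open>The conjugation in \<open>MLB\<close> undoes the \<open>cnj z\<close> of the kernel, so
  that powers of \<open>z\<close> itself appear. Summability of the integrals of the norms of the
  terms yields integrability of the whole integrand together with the series.\<close>

lemma MLB_sums:
  assumes q: "q > 0" and \<phi>: "hermite.square_integrable \<phi>"
  shows integrable_MLB: "integrable lebesgue (\<lambda>x. cnj (MLB_kernel q z x) * \<phi> x)"
    and sums_MLB: "(\<lambda>n. MLB_coeff q (hermite.fourier_coeff \<phi>) n * z ^ n) sums MLB q \<phi> z"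
proof -
  let ?f = "\<lambda>n x. cnj (MLB_kernel_term q z x n) * \<phi> x"
  have sN: "summable (\<lambda>n. norm (MLB_kernel_term q z x n))" for x
    by (rule summable_norm_MLB_kernel_term[OF q])
  have feq: "?f n x = z ^ n / of_real (sqrt (Gamma (q * real n + 1))) * (of_real (hermite_fun n x) * \<phi> x)" for n x
    by (simp add: MLB_kernel_term_def)
  have suminf: "(\<Sum>n. ?f n x) = cnj (MLB_kernel q z x) * \<phi> x" for x
  proof -
    have "(\<lambda>n. cnj (MLB_kernel_term q z x n)) sums cnj (MLB_kernel q z x)"
      unfolding MLB_kernel_def using summable_sums[OF summable_norm_cancel[OF sN]] by (simp only: sums_cnj)
    from sums_mult2[OF this, of "\<phi> x"] show ?thesis
      by (simp only: sums_unique[symmetric])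
  qed
  \<comment> \<open>AM-GM with weight 1 bounds every integral of
    \<open>\<bar>hermite_fun n x\<bar> * norm (\<phi> x)\<close> by this number, independently of
    \<open>n\<close>.\<close>
  define B where "B = 1 + (\<integral>x. (norm (\<phi> x))\<^sup>2 \<partial>lebesgue)"
  have int: "integrable lebesgue (?f n)" for n
    unfolding feq by (intro integrable_mult_right hermite.integrable_e_mult \<phi>)
  have AE: "AE x in lebesgue. summable (\<lambda>n. norm (?f n x))"
    using sN by (simp add: norm_mult summable_mult2)
  have summ: "summable (\<lambda>n. \<integral>x. norm (?f n x) \<partial>lebesgue)"
  proof (rule summable_comparison_test)
    show "summable (\<lambda>n. norm z ^ n / sqrt (Gamma (q * real n + 1)) * B)"
      by (intro summable_mult2 summable_power_over_sqrt_Gamma q) simp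
    have "norm (\<integral>x. norm (?f n x) \<partial>lebesgue) \<le> norm z ^ n / sqrt (Gamma (q * real n + 1)) * B" for n
    proof -
      let ?c = "norm z ^ n / sqrt (Gamma (q * real n + 1))"
      have e2: "integrable lebesgue (\<lambda>x. (hermite_fun n x)\<^sup>2)" "(\<integral>x. (hermite_fun n x)\<^sup>2 \<partial>lebesgue) = 1"
        using hermite.integrable_e[of n n] hermite.orthonormal[of n n] by (simp_all add: power2_eq_square)
      have \<phi>2: "integrable lebesgue (\<lambda>x. (norm (\<phi> x))\<^sup>2)"
        using \<phi> by (simp add: hermite.square_integrable_def)
      have "(\<integral>x. norm (of_real (hermite_fun n x) * \<phi> x) \<partial>lebesgue) \<le>
          (\<integral>x. (hermite_fun n x)\<^sup>2 + (norm (\<phi> x))\<^sup>2 \<partial>lebesgue)"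
      proof (rule integral_mono)
        show "norm (of_real (hermite_fun n x) * \<phi> x) \<le> (hermite_fun n x)\<^sup>2 + (norm (\<phi> x))\<^sup>2" for x
          using norm_mult_le_weighted_squares[of 1 "of_real (hermite_fun n x)" "\<phi> x"] by simp
      qed (use hermite.integrable_e_mult[OF \<phi>] e2 \<phi>2 in auto)
      also have "\<dots> = B"
        using e2 \<phi>2 by (simp add: B_def)
      finally have le: "(\<integral>x. norm (of_real (hermite_fun n x) * \<phi> x) \<partial>lebesgue) \<le> B" .
      have "norm (\<integral>x. norm (?f n x) \<partial>lebesgue) = (\<integral>x. norm (?f n x) \<partial>lebesgue)"
        by simp
      also have "\<dots> = (\<integral>x. ?c * norm (of_real (hermite_fun n x) * \<phi> x) \<partial>lebesgue)"
        using Gamma_mult_nat_pos[OF q, of n]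
        by (intro Bochner_Integration.integral_cong refl)
          (simp add: feq norm_mult norm_divide norm_power)
      also have "\<dots> = ?c * (\<integral>x. norm (of_real (hermite_fun n x) * \<phi> x) \<partial>lebesgue)"
        by (rule integral_mult_right_zero)
      also have "\<dots> \<le> ?c * B"
        using Gamma_mult_nat_pos[OF q, of n] by (intro mult_left_mono le) auto
      finally show ?thesis .
    qed
    then show "\<exists>N. \<forall>n\<ge>N. norm (\<integral>x. norm (?f n x) \<partial>lebesgue) \<le> norm z ^ n / sqrt (Gamma (q * real n + 1)) * B"
      by blast
  qed
  show "integrable lebesgue (\<lambda>x. cnj (MLB_kernel q z x) * \<phi> x)"
    using integrable_suminf[OF int AE summ] by (simp only: suminf)
  have "(\<lambda>n. \<integral>x. ?f n x \<partial>lebesgue) sums MLB q \<phi> z"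
    using sums_integral[OF int AE summ] by (simp only: suminf MLB_def)
  moreover have "(\<integral>x. ?f n x \<partial>lebesgue) = MLB_coeff q (hermite.fourier_coeff \<phi>) n * z ^ n" for n
    unfolding feq integral_mult_right_zero MLB_coeff_def hermite.fourier_coeff_def by simp
  ultimately show "(\<lambda>n. MLB_coeff q (hermite.fourier_coeff \<phi>) n * z ^ n) sums MLB q \<phi> z"
    by simp
qed

lemma norm_MLB_coeff:
  assumes "q > 0"
  shows "(norm (MLB_coeff q a n))\<^sup>2 * Gamma (q * real n + 1) = (norm (a n))\<^sup>2"
  using Gamma_mult_nat_pos[OF assms, of n]
  by (simp add: MLB_coeff_def norm_divide power_divide)

text \<open>The Gamma factors of the Fock norm cancel those of \<open>MLB_coeff\<close>; the sum of
  squared Hermite coefficients that remains is evaluated by Parseval.\<close>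

lemma nn_integral_MLB:
  assumes q: "q > 0" and \<phi>: "hermite.square_integrable \<phi>"
  shows "(\<integral>\<^sup>+z. ennreal ((norm (MLB q \<phi> z))\<^sup>2 * mittag_leffler_density q z) \<partial>lborel) =
    ennreal (q * pi * (\<integral>x. (norm (\<phi> x))\<^sup>2 \<partial>lebesgue))"
proof -
  have "(\<Sum>n. ennreal ((norm (MLB_coeff q (hermite.fourier_coeff \<phi>) n))\<^sup>2 * Gamma (q * real n + 1))) =
      ennreal (\<integral>x. (norm (\<phi> x))\<^sup>2 \<partial>lebesgue)"
    unfolding norm_MLB_coeff[OF q] hermite_parseval[OF \<phi>]
    using hermite.bessel[OF \<phi>] by (intro suminf_ennreal2) auto
  then show ?thesis
    using q by (simp add: nn_integral_mittag_leffler_power_series[OF q sums_MLB[OF q \<phi>]] ennreal_mult)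
qed

section \<open>Isometry onto the Fock space\<close>

lemma holomorphic_MLB:
  assumes "q > 0" "hermite.square_integrable \<phi>"
  shows "MLB q \<phi> holomorphic_on UNIV"
proof -
  have "MLB q \<phi> holomorphic_on ball 0 (norm w + 1)" for w :: complex
    by (rule power_series_holomorphic[where a="MLB_coeff q (hermite.fourier_coeff \<phi>)"])
      (simp add: sums_MLB assms)
  then have "MLB q \<phi> field_differentiable at w" for w
    using holomorphic_on_imp_differentiable_at[of "MLB q \<phi>" "ball 0 (norm w + 1)" w] by simp
  then show ?thesis
    by (simp add: holomorphic_on_def)
qed

lemma borel_measurable_mittag_leffler_integrand:
  assumes "f holomorphic_on UNIV"
  shows "(\<lambda>z. (norm (f z))\<^sup>2 * mittag_leffler_density q z) \<in> borel_measurable borel"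
proof -
  have [measurable]: "f \<in> borel_measurable borel"
    by (intro borel_measurable_continuous_onI holomorphic_on_imp_continuous_on assms)
  show ?thesis
    unfolding mittag_leffler_density_def by measurable
qed

lemma mittag_leffler_integrand_nonneg: "(norm (f z))\<^sup>2 * mittag_leffler_density q z \<ge> 0"
  by (simp add: mittag_leffler_density_def)

text \<open>A finite value of the nonnegative integral gives integrability and the value of the
  Bochner integral together, hence both membership and norm. The factor \<open>q * pi\<close>
  cancels against the normalization in \<open>mittag_leffler_norm\<close>.\<close>

lemma MLB_isometry:
  assumes q: "q > 0" and \<phi>: "\<phi> \<in> L2"
  shows "MLB q \<phi> \<in> mittag_leffler_Fock q" "mittag_leffler_norm q (MLB q \<phi>) = L2_norm \<phi>"
proof -
  let ?W = "\<lambda>z. (norm (MLB q \<phi> z))\<^sup>2 * mittag_leffler_density q z"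
  have \<phi>': "hermite.square_integrable \<phi>"
    using \<phi> by (simp add: L2_eq)
  have W: "?W \<in> borel_measurable borel"
    by (intro borel_measurable_mittag_leffler_integrand holomorphic_MLB q \<phi>')
  have "has_bochner_integral lborel ?W (q * pi * (\<integral>x. (norm (\<phi> x))\<^sup>2 \<partial>lebesgue))"
    using q W mittag_leffler_integrand_nonneg nn_integral_MLB[OF q \<phi>']
    by (intro has_bochner_integral_nn_integral) auto
  then have i: "integrable lebesgue ?W" "integral\<^sup>L lebesgue ?W = q * pi * (\<integral>x. (norm (\<phi> x))\<^sup>2 \<partial>lebesgue)"
    using W by (auto simp: has_bochner_integral_iff integrable_completion integral_completion)
  show "MLB q \<phi> \<in> mittag_leffler_Fock q"
    using i(1) holomorphic_MLB[OF q \<phi>'] by (simp add: mittag_leffler_Fock_def)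
  show "mittag_leffler_norm q (MLB q \<phi>) = L2_norm \<phi>"
    using q by (simp add: mittag_leffler_norm_def L2_norm_def i(2))
qed

lemma MLB_surj:
  assumes q: "q > 0" and f: "f \<in> mittag_leffler_Fock q"
  shows "f \<in> MLB q ` L2"
proof -
  have hol: "f holomorphic_on UNIV"
    and int: "integrable lebesgue (\<lambda>z. (norm (f z))\<^sup>2 * mittag_leffler_density q z)"
    using f by (auto simp: mittag_leffler_Fock_def)
  define c where "c = (\<lambda>n. (deriv ^^ n) f 0 / fact n)"
  have c: "(\<lambda>n. c n * z ^ n) sums f z" for z
    using holomorphic_power_series[of f 0 "norm z + 1" z] holomorphic_on_subset[OF hol]
    by (simp add: c_def)
  define a where "a = (\<lambda>n. c n * of_real (sqrt (Gamma (q * real n + 1))))"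
  have ca: "MLB_coeff q a n = c n" for n
    using Gamma_mult_nat_pos[OF q, of n] by (simp add: MLB_coeff_def a_def)
  \<comment> \<open>The Fock norm formula read from function to coefficients: a finite Fock norm
    forces the rescaled Taylor coefficients \<open>a\<close> to be square summable.\<close>
  have "ennreal (q * pi) * (\<Sum>n. ennreal ((norm (a n))\<^sup>2)) =
      (\<integral>\<^sup>+z. ennreal ((norm (f z))\<^sup>2 * mittag_leffler_density q z) \<partial>lborel)"
    unfolding nn_integral_mittag_leffler_power_series[OF q c] norm_MLB_coeff[OF q, of a, symmetric] ca ..
  also have "\<dots> < \<infinity>"
    using int mittag_leffler_integrand_nonneg[of f _ q]
    by (simp add: integrable_iff_bounded nn_integral_completion)
  finally have "(\<Sum>n. ennreal ((norm (a n))\<^sup>2)) \<noteq> \<infinity>"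
    using q by (auto simp: ennreal_mult_less_top)
  then have "summable (\<lambda>n. (norm (a n))\<^sup>2)"
    by (intro summable_suminf_not_top) auto
  then obtain \<phi> where \<phi>: "hermite.square_integrable \<phi>" "\<And>n. hermite.fourier_coeff \<phi> n = a n"
    using hermite.riesz_fischer by metis
  have "hermite.fourier_coeff \<phi> = a"
    using \<phi>(2) by auto
  then have "MLB q \<phi> z = f z" for z
    using sums_MLB[OF q \<phi>(1), of z] c[of z] sums_unique2 by (simp add: ca) blast
  then show ?thesis
    using \<phi>(1) by (auto simp: L2_eq image_iff fun_eq_iff)
qed

lemma MLB_linear:
  assumes q: "q > 0" and "\<phi> \<in> L2" "\<psi> \<in> L2"
  shows "MLB q (\<lambda>x. a * \<phi> x + b * \<psi> x) = (\<lambda>z. a * MLB q \<phi> z + b * MLB q \<psi> z)"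
proof
  fix z
  have i: "integrable lebesgue (\<lambda>x. cnj (MLB_kernel q z x) * \<phi> x)" "integrable lebesgue (\<lambda>x. cnj (MLB_kernel q z x) * \<psi> x)"
    using assms by (simp_all add: L2_eq integrable_MLB)
  have "MLB q (\<lambda>x. a * \<phi> x + b * \<psi> x) z =
      (\<integral>x. a * (cnj (MLB_kernel q z x) * \<phi> x) + b * (cnj (MLB_kernel q z x) * \<psi> x) \<partial>lebesgue)"
    unfolding MLB_def by (simp add: algebra_simps)
  also have "\<dots> = a * MLB q \<phi> z + b * MLB q \<psi> z"
    unfolding MLB_def using i by simp
  finally show "MLB q (\<lambda>x. a * \<phi> x + b * \<psi> x) z = a * MLB q \<phi> z + b * MLB q \<psi> z" .
qed

text \<open>Injectivity is the isometry applied to the difference. Conversely, each value of the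
  transform is an integral and ignores null sets, so equality almost everywhere of the arguments
  gives equality at every \<open>z\<close>.\<close>

lemma MLB_eq_iff:
  assumes q: "q > 0" and "\<phi> \<in> L2" "\<psi> \<in> L2"
  shows "MLB q \<phi> = MLB q \<psi> \<longleftrightarrow> (AE x in lebesgue. \<phi> x = \<psi> x)"
proof
  let ?d = "\<lambda>x. \<phi> x - \<psi> x"
  have d: "?d \<in> L2"
    using assms by (simp add: L2_eq hermite.square_integrable_diff)
  assume "MLB q \<phi> = MLB q \<psi>"
  then have "MLB q ?d = (\<lambda>z. 0)"
    using MLB_linear[OF assms, of 1 "-1"] by simp
  then have "L2_norm ?d = 0"
    using MLB_isometry(2)[OF q d] by (simp add: mittag_leffler_norm_def)
  then have "AE x in lebesgue. (norm (?d x))\<^sup>2 = 0"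
    using d by (subst integral_nonneg_eq_0_iff_AE[symmetric]) (auto simp: L2_norm_def L2_def)
  then show "AE x in lebesgue. \<phi> x = \<psi> x"
    by simp
next
  assume ae: "AE x in lebesgue. \<phi> x = \<psi> x"
  show "MLB q \<phi> = MLB q \<psi>"
  proof
    fix z
    have "integrable lebesgue (\<lambda>x. cnj (MLB_kernel q z x) * \<phi> x)" "integrable lebesgue (\<lambda>x. cnj (MLB_kernel q z x) * \<psi> x)"
      using assms by (simp_all add: L2_eq integrable_MLB)
    then show "MLB q \<phi> z = MLB q \<psi> z"
      unfolding MLB_def using ae by (intro integral_cong_AE) (auto dest: borel_measurable_integrable)
  qed
qed

text \<open>The first two conjuncts certify that \<open>MLB\<close> is built from convergent series
  and genuine integrals, not from default values of \<open>suminf\<close> and the Bochner integral.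
  Injectivity refers to equality almost everywhere because elements of \<open>L2\<close> are
  functions. Preservation of inner products is contained in linearity and norm preservation, by
  polarization.\<close>

theorem theorem3p7:
  fixes q :: real
  assumes "q > 0"
  shows "(\<forall>z x. summable (MLB_kernel_term q z x))
    \<and> (\<forall>\<phi>\<in>L2. \<forall>z. integrable lebesgue (\<lambda>x. cnj (MLB_kernel q z x) * \<phi> x))
    \<and> (\<forall>\<phi>\<in>L2. \<forall>\<psi>\<in>L2. \<forall>a b :: complex.
          MLB q (\<lambda>x. a * \<phi> x + b * \<psi> x) = (\<lambda>z. a * MLB q \<phi> z + b * MLB q \<psi> z))
    \<and> (\<forall>\<phi>\<in>L2. mittag_leffler_norm q (MLB q \<phi>) = L2_norm \<phi>)
    \<and> (\<forall>\<phi>\<in>L2. \<forall>\<psi>\<in>L2. MLB q \<phi> = MLB q \<psi> \<longleftrightarrow> (AE x in lebesgue. \<phi> x = \<psi> x))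
    \<and> MLB q ` L2 = mittag_leffler_Fock q"
proof (intro conjI allI ballI)
  show "summable (MLB_kernel_term q z x)" for z x
    by (rule summable_norm_cancel[OF summable_norm_MLB_kernel_term[OF assms]])
  show "integrable lebesgue (\<lambda>x. cnj (MLB_kernel q z x) * \<phi> x)" if "\<phi> \<in> L2" for \<phi> z
    using that assms by (simp add: L2_eq integrable_MLB)
  show "MLB q ` L2 = mittag_leffler_Fock q"
    using MLB_isometry(1)[OF assms] MLB_surj[OF assms] by blast
qed (use assms in \<open>simp_all add: MLB_linear MLB_isometry MLB_eq_iff\<close>)

end
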